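(* Let $n \geq 3$ and let $A$ be an $n$-dimensional algebra over $\mathbb{C}$ of level one. Then $A$ is isomorphic to one of the following algebras: $$p_n^{-}, \qquad n_3^{-} \oplus a_{n-3}, \qquad \lambda_2 \oplus a_{n-2}, \qquad \nu_n(\alpha) \ \text{ with } \alpha \in \mathbb{C}.$$
   Context: An $n$-dimensional algebra over $\mathbb{C}$ is an $n$-dimensional complex vector space $V$ with an arbitrary bilinear map $\lambda: V\times V\to V$ (no identities such as associativity, commutativity or existence of a unit are assumed), i.e. a point $\lambda$ of the $n^3$-dimensional affine space $\mathrm{Hom}(V\otimes V,V)$. The group $GL_n(\mathbb{C})=GL(V)$ acts by $(g*\lambda)(x,y)=g(\lambda(g^{-1}(x),g^{-1}(y)))$; the orbit $Orb(\lambda)$ is the isomorphism class of $\lambda$. Degeneration: for $n$-dimensional complex algebras $\lambda,\mu$, we say $\lambda$ degenerates to $\mu$, written $\lambda\to\mu$, if $Orb(\mu)$ lies in the Zariski closure of $Orb(\lambda)$ in $\mathrm{Hom}(V\otimes V,V)$. A degeneration $\lambda\to\mu$ is non-trivial if $\lambda$ and $\mu$ are not isomorphic. A (non-trivial) degeneration $\lambda\to\mu$ is direct if there is no chain $\lambda\to\nu\to\mu$ of non-trivial degenerations. The level $lev_n(\lambda)$ of an $n$-dimensional algebra $\lambda$ is the maximum length (number of arrows) of a chain of direct degenerations starting at $\lambda$. Every $n$-dimensional algebra degenerates to the abelian algebra $a_n$ (the $n$-dimensional algebra with zero multiplication), so $A$ has level one exactly when $A$ is not abelian and every algebra to which $A$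 degenerates is isomorphic to $A$ or to $a_n$. Notation (all products of basis vectors not listed are zero; $\oplus$ is the direct sum of algebras; $a_m$ is the $m$-dimensional algebra with zero multiplication, with $a_0=0$): - $p_n^{-}$: basis $e_1,\dots,e_n$, with $e_1e_i=e_i$, $e_ie_1=-e_i$ for $2\le i\le n$. - $n_3^{-}$: basis $e_1,e_2,e_3$, with $e_1e_2=e_3$, $e_2e_1=-e_3$. - $\lambda_2$: basis $e_1,e_2$, with $e_1e_1=e_2$. - $\nu_n(\alpha)$: basis $e_1,\dots,e_n$, with $e_1e_1=e_1$, $e_1e_i=\alpha e_i$, $e_ie_1=(1-\alpha)e_i$ for $2\le i\le n$. *)

theory Defs
  imports "Jordan_Normal_Form.Matrix" "HOL-Library.Extended_Nat"
begin

section \<open>The variety of n-dimensional complex algebras\<close>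

text \<open>
  The underlying space is \<open>V = carrier_vec n\<close>, that is, complex column vectors of length \<open>n\<close>.
  A multiplication is a HOL function on \<^typ>\<open>complex vec\<close>; only its values on \<open>V \<times> V\<close> matter,
  and all notions below depend on these values only. Coordinates and basis vectors are
  numbered from 0, so \<open>unit_vec n i\<close> plays the role of the basis vector \<open>e\<close> with number \<open>i + 1\<close>.
\<close>

type_synonym mult = "complex vec \<Rightarrow> complex vec \<Rightarrow> complex vec"

definition algebras :: "nat \<Rightarrow> mult set" where
  "algebras n = {\<phi>.
     (\<forall>x\<in>carrier_vec n. \<forall>y\<in>carrier_vec n. \<phi> x y \<in> carrier_vec n) \<and>
     (\<forall>x\<in>carrier_vec n. \<forall>x'\<in>carrier_vec n. \<forall>y\<in>carrier_vec n. \<phi> (x + x') y = \<phi> x y + \<phi> x' y) \<and>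
     (\<forall>x\<in>carrier_vec n. \<forall>y\<in>carrier_vec n. \<forall>y'\<in>carrier_vec n. \<phi> x (y + y') = \<phi> x y + \<phi> x y') \<and>
     (\<forall>c. \<forall>x\<in>carrier_vec n. \<forall>y\<in>carrier_vec n. \<phi> (c \<cdot>\<^sub>v x) y = c \<cdot>\<^sub>v \<phi> x y) \<and>
     (\<forall>c. \<forall>x\<in>carrier_vec n. \<forall>y\<in>carrier_vec n. \<phi> x (c \<cdot>\<^sub>v y) = c \<cdot>\<^sub>v \<phi> x y)}"

definition alg_iso :: "nat \<Rightarrow> mult \<Rightarrow> mult \<Rightarrow> bool" where
  "alg_iso n \<phi> \<mu> \<longleftrightarrow> (\<exists>g\<in>carrier_mat n n. invertible_mat g \<and>
     (\<forall>x\<in>carrier_vec n. \<forall>y\<in>carrier_vec n. g *\<^sub>v \<phi> x y = \<mu> (g *\<^sub>v x) (g *\<^sub>v y)))"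

text \<open>In the next definition \<open>h\<close> is the inverse of \<open>g\<close>.\<close>

definition orb :: "nat \<Rightarrow> mult \<Rightarrow> mult set" where
  "orb n \<phi> = {\<mu>\<in>algebras n. \<exists>g\<in>carrier_mat n n. \<exists>h\<in>carrier_mat n n.
     inverts_mat g h \<and> inverts_mat h g \<and>
     (\<forall>x\<in>carrier_vec n. \<forall>y\<in>carrier_vec n. \<mu> x y = g *\<^sub>v \<phi> (h *\<^sub>v x) (h *\<^sub>v y))}"


section \<open>Zariski closure and degenerations\<close>

text \<open>
  Polynomial functions on the affine space of multiplications, in the \<open>n\<^sup>3\<close> structure constants
  (the coefficients of the products of basis vectors) as coordinates.
\<close>

inductive_set poly_funs :: "nat \<Rightarrow> (mult \<Rightarrow> complex) set" for n :: nat where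
  const: "(\<lambda>_. c) \<in> poly_funs n"
| coord: "i < n \<Longrightarrow> j < n \<Longrightarrow> k < n \<Longrightarrow> (\<lambda>m. m (unit_vec n i) (unit_vec n j) $ k) \<in> poly_funs n"
| add: "p \<in> poly_funs n \<Longrightarrow> q \<in> poly_funs n \<Longrightarrow> (\<lambda>m. p m + q m) \<in> poly_funs n"
| mult: "p \<in> poly_funs n \<Longrightarrow> q \<in> poly_funs n \<Longrightarrow> (\<lambda>m. p m * q m) \<in> poly_funs n"

definition zariski_closure :: "nat \<Rightarrow> mult set \<Rightarrow> mult set" where
  "zariski_closure n S =
     {\<mu>\<in>algebras n. \<forall>p\<in>poly_funs n. (\<forall>\<phi>\<in>S. p \<phi> = 0) \<longrightarrow> p \<mu> = 0}"

definition degenerates :: "nat \<Rightarrow> mult \<Rightarrow> mult \<Rightarrow> bool" where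
  "degenerates n \<phi> \<mu> \<longleftrightarrow> \<phi> \<in> algebras n \<and> \<mu> \<in> algebras n \<and>
     orb n \<mu> \<subseteq> zariski_closure n (orb n \<phi>)"

definition nontrivial_degen :: "nat \<Rightarrow> mult \<Rightarrow> mult \<Rightarrow> bool" where
  "nontrivial_degen n \<phi> \<mu> \<longleftrightarrow> degenerates n \<phi> \<mu> \<and> \<not> alg_iso n \<phi> \<mu>"

definition direct_degen :: "nat \<Rightarrow> mult \<Rightarrow> mult \<Rightarrow> bool" where
  "direct_degen n \<phi> \<mu> \<longleftrightarrow> nontrivial_degen n \<phi> \<mu> \<and>
     \<not> (\<exists>\<nu>. nontrivial_degen n \<phi> \<nu> \<and> nontrivial_degen n \<nu> \<mu>)"

text \<open>
  The relation power with exponent \<open>k\<close> describes chains with \<open>k\<close> arrows. The supremum is taken in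
  \<^typ>\<open>enat\<close>, so it is finite exactly when a longest chain exists, and is then its length.
\<close>

definition level :: "nat \<Rightarrow> mult \<Rightarrow> enat" where
  "level n \<phi> = Sup {enat k | k. \<exists>\<mu>. (direct_degen n ^^ k) \<phi> \<mu>}"


section \<open>The algebras of the classification\<close>

definition mult_table :: "nat \<Rightarrow> (nat \<Rightarrow> nat \<Rightarrow> complex vec) \<Rightarrow> mult" where
  "mult_table n t x y = vec n (\<lambda>k. \<Sum>i<n. \<Sum>j<n. x $ i * y $ j * (t i j $ k))"

definition p_minus :: "nat \<Rightarrow> mult" where
  "p_minus n = mult_table n (\<lambda>i j.
     if i = 0 \<and> j \<noteq> 0 then unit_vec n j
     else if i \<noteq> 0 \<and> j = 0 then - unit_vec n i
     else 0\<^sub>v n)"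

definition n3_minus :: mult where
  "n3_minus = mult_table 3 (\<lambda>i j.
     if i = 0 \<and> j = 1 then unit_vec 3 2
     else if i = 1 \<and> j = 0 then - unit_vec 3 2
     else 0\<^sub>v 3)"

definition lambda2 :: mult where
  "lambda2 = mult_table 2 (\<lambda>i j. if i = 0 \<and> j = 0 then unit_vec 2 1 else 0\<^sub>v 2)"

definition nu :: "nat \<Rightarrow> complex \<Rightarrow> mult" where
  "nu n \<alpha> = mult_table n (\<lambda>i j.
     if i = 0 \<and> j = 0 then unit_vec n 0
     else if i = 0 then \<alpha> \<cdot>\<^sub>v unit_vec n j
     else if j = 0 then (1 - \<alpha>) \<cdot>\<^sub>v unit_vec n i
     else 0\<^sub>v n)"

definition abelian :: "nat \<Rightarrow> mult" where
  "abelian m x y = 0\<^sub>v m"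

definition alg_sum :: "nat \<Rightarrow> nat \<Rightarrow> mult \<Rightarrow> mult \<Rightarrow> mult" where
  "alg_sum m l \<phi> \<mu> x y =
     \<phi> (vec_first x m) (vec_first y m) @\<^sub>v \<mu> (vec_last x l) (vec_last y l)"


section \<open>Basic facts\<close>

lemma mult_table_unit_vec:
  assumes "i < n" "j < n" "t i j \<in> carrier_vec n"
  shows "mult_table n t (unit_vec n i) (unit_vec n j) = t i j"
proof (rule eq_vecI)
  fix k assume k: "k < dim_vec (t i j)"
  have "(\<Sum>a<n. \<Sum>b<n. unit_vec n i $ a * unit_vec n j $ b * (t a b $ k))
      = (\<Sum>a<n. \<Sum>b<n. if b = j then (if a = i then t a b $ k else 0) else 0)"
    using assms by (intro sum.cong refl) (auto simp: unit_vec_def)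
  also have "\<dots> = t i j $ k"
    using assms by (simp add: sum.delta)
  finally show "mult_table n t (unit_vec n i) (unit_vec n j) $ k = t i j $ k"
    using k assms by (simp add: mult_table_def)
qed (use assms in \<open>simp add: mult_table_def\<close>)

lemma mult_table_algebras: "mult_table n t \<in> algebras n"
  unfolding algebras_def mult_table_def
  by (auto simp: sum_distrib_left sum.distrib[symmetric] algebra_simps intro!: eq_vecI sum.cong)

lemma abelian_algebras: "abelian m \<in> algebras m"
  by (auto simp: algebras_def abelian_def)

lemma alg_sum_algebras:
  assumes "\<phi> \<in> algebras m" "\<mu> \<in> algebras l"
  shows "alg_sum m l \<phi> \<mu> \<in> algebras (m + l)"
proof -
  have f: "vec_first x m \<in> carrier_vec m" "vec_last x l \<in> carrier_vec l" for x :: "complex vec"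
    by (auto simp: vec_first_def vec_last_def)
  have a: "vec_first (x + y) m = vec_first x m + vec_first y m"
          "vec_last (x + y) l = vec_last x l + vec_last y l"
    if "x \<in> carrier_vec (m + l)" "y \<in> carrier_vec (m + l)" for x y :: "complex vec"
    using that by (auto simp: vec_first_def vec_last_def)
  have s: "vec_first (c \<cdot>\<^sub>v x) m = c \<cdot>\<^sub>v vec_first x m"
          "vec_last (c \<cdot>\<^sub>v x) l = c \<cdot>\<^sub>v vec_last x l"
    if "x \<in> carrier_vec (m + l)" for c and x :: "complex vec"
    using that by (auto simp: vec_first_def vec_last_def)
  have app: "(u + u') @\<^sub>v (w + w') = (u @\<^sub>v w) + (u' @\<^sub>v w')"
    if "u \<in> carrier_vec m" "u' \<in> carrier_vec m" "w \<in> carrier_vec l" "w' \<in> carrier_vec l"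
    for u u' w w' :: "complex vec"
    using that by (auto simp: append_vec_def Let_def)
  have sapp: "(c \<cdot>\<^sub>v u) @\<^sub>v (c \<cdot>\<^sub>v w) = c \<cdot>\<^sub>v (u @\<^sub>v w)"
    if "u \<in> carrier_vec m" "w \<in> carrier_vec l" for c and u w :: "complex vec"
    using that by (auto simp: append_vec_def Let_def)
  show ?thesis
    using assms unfolding algebras_def alg_sum_def mem_Collect_eq
    by (simp add: a s f app sapp append_carrier_vec)
qed

lemma orb_iff_alg_iso:
  assumes "\<phi> \<in> algebras n" "\<mu> \<in> algebras n"
  shows "\<mu> \<in> orb n \<phi> \<longleftrightarrow> alg_iso n \<phi> \<mu>"
proof
  assume "\<mu> \<in> orb n \<phi>"
  then obtain g h where g: "g \<in> carrier_mat n n" and h: "h \<in> carrier_mat n n"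
    and inv: "inverts_mat g h" "inverts_mat h g"
    and eq: "\<And>x y. x \<in> carrier_vec n \<Longrightarrow> y \<in> carrier_vec n \<Longrightarrow> \<mu> x y = g *\<^sub>v \<phi> (h *\<^sub>v x) (h *\<^sub>v y)"
    unfolding orb_def by auto
  have hg: "h *\<^sub>v (g *\<^sub>v x) = x" if "x \<in> carrier_vec n" for x
    using that g h inv by (simp add: assoc_mult_mat_vec[symmetric] inverts_mat_def)
  have "g *\<^sub>v \<phi> x y = \<mu> (g *\<^sub>v x) (g *\<^sub>v y)" if "x \<in> carrier_vec n" "y \<in> carrier_vec n" for x y
    using eq[of "g *\<^sub>v x" "g *\<^sub>v y"] that g by (simp add: hg)
  moreover have "invertible_mat g"
    using g inv unfolding invertible_mat_def by auto
  ultimately show "alg_iso n \<phi> \<mu>"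
    unfolding alg_iso_def using g by blast
next
  assume "alg_iso n \<phi> \<mu>"
  then obtain g h where g: "g \<in> carrier_mat n n"
    and inv: "inverts_mat g h" "inverts_mat h g"
    and eq: "\<And>x y. x \<in> carrier_vec n \<Longrightarrow> y \<in> carrier_vec n \<Longrightarrow> g *\<^sub>v \<phi> x y = \<mu> (g *\<^sub>v x) (g *\<^sub>v y)"
    unfolding alg_iso_def invertible_mat_def by blast
  have "dim_col (g * h) = n" "dim_col (h * g) = dim_row h"
    using g inv unfolding inverts_mat_def by auto
  then have h: "h \<in> carrier_mat n n"
    using g by auto
  have gh: "g *\<^sub>v (h *\<^sub>v x) = x" if "x \<in> carrier_vec n" for x
    using that g h inv by (simp add: assoc_mult_mat_vec[symmetric] inverts_mat_def)
  have "\<mu> x y = g *\<^sub>v \<phi> (h *\<^sub>v x) (h *\<^sub>v y)" if "x \<in> carrier_vec n" "y \<in> carrier_vec n" for x y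
    using eq[of "h *\<^sub>v x" "h *\<^sub>v y"] that h by (simp add: gh)
  then show "\<mu> \<in> orb n \<phi>"
    unfolding orb_def using assms g h inv by blast
qed

end

(* Degenerations never increase the transcendence degree of the ring of polynomial functions on
   an orbit, and a non-trivial one strictly decreases it: if the degrees agree, the two orbit closures
   agree, and an orbit contains a dense open subset of its closure, so the orbits agree. Hence an
   algebra with a non-trivial degeneration to a non-zero algebra starts a chain of two direct
   degenerations, and an algebra A of level one degenerates only to itself and to zero.

   Such an A is degenerated explicitly along bases t^(w i) v i, t -> 0, which keeps the structure
   constants with w i + w j = w k provided those with w i + w j < w k vanish:
   - if some xx is not in Cx, start with x, xx and use weights 1,2,2,...: the limit is lambda_2 + a;
   - else, if some xy is not in the span of x and y, start with x, y, xy and use weights 1,1,2,2,...: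
     the limit is n_3^- + a;
   - else xy = g(x) y + h(y) x for linear forms g and h; start with x such that g(x) or h(x) is
     non-zero and use weights 0,1,1,...: the limit is p_n^- or nu_n(alpha). *)

theory Submission
  imports Defs "HOL-Library.Function_Algebras" "HOL-Computational_Algebra.Fundamental_Theorem_Algebra"
    "Jordan_Normal_Form.Determinant"
begin

section \<open>Subrings without zero divisors\<close>

text \<open>The level counts direct degenerations only, and a non-trivial degeneration need not be
  direct. Refining it into direct ones requires a bounded quantity that drops strictly at each
  arrow; this is why a dimension of orbits has to be available before any algebra is classified.

  The drop rests on two facts about an orbit: its coordinate ring is a domain, and it is large in
  its closure. Both are obtained inside rings of complex functions of a pair (g, g^-1). The ring of
  all functions does have zero divisors, so their absence is stated as a property of a subset, and
  fractions are replaced by pseudo-division. The second fact is a form of Chevalley's theorem: a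
  homomorphism to C extends to a finitely generated overring as soon as one suitable non-zero
  element is not killed.

  The explicit degenerations need only analysis: polynomials are continuous, so an ordinary limit of
  points of an orbit lies in its Zariski closure.\<close>

definition is_subring :: "'a::comm_ring_1 set \<Rightarrow> bool" where
  "is_subring R \<longleftrightarrow> 1 \<in> R \<and> (\<forall>a\<in>R. \<forall>b\<in>R. a - b \<in> R \<and> a * b \<in> R)"

definition zero_divisor_free :: "'a::comm_ring_1 set \<Rightarrow> bool" where
  "zero_divisor_free R \<longleftrightarrow> (\<forall>a\<in>R. \<forall>b\<in>R. a * b = 0 \<longrightarrow> a = 0 \<or> b = 0)"

definition ring_hom_on :: "'a::comm_ring_1 set \<Rightarrow> ('a \<Rightarrow> complex) \<Rightarrow> bool" where
  "ring_hom_on R \<phi> \<longleftrightarrow> \<phi> 1 = 1 \<and>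
     (\<forall>a\<in>R. \<forall>b\<in>R. \<phi> (a + b) = \<phi> a + \<phi> b \<and> \<phi> (a * b) = \<phi> a * \<phi> b)"

definition polys_over :: "'a::comm_ring_1 set \<Rightarrow> 'a poly set" where
  "polys_over R = {p. \<forall>i. coeff p i \<in> R}"

definition adjoin :: "'a::comm_ring_1 set \<Rightarrow> 'a \<Rightarrow> 'a set" where
  "adjoin R x = (\<lambda>p. poly p x) ` polys_over R"

text \<open>The leading coefficient is only required to be non-zero: for \<open>R\<close> without
  zero divisors this is algebraicity over its field of fractions, not integrality.\<close>

definition algebraic_over :: "'a::comm_ring_1 set \<Rightarrow> 'a \<Rightarrow> bool" where
  "algebraic_over R x \<longleftrightarrow> (\<exists>p\<in>polys_over R. p \<noteq> 0 \<and> poly p x = 0)"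

lemma is_subringD:
  assumes "is_subring R"
  shows "1 \<in> R" "0 \<in> R" "a \<in> R \<Longrightarrow> b \<in> R \<Longrightarrow> a - b \<in> R" "a \<in> R \<Longrightarrow> b \<in> R \<Longrightarrow> a * b \<in> R"
    "a \<in> R \<Longrightarrow> b \<in> R \<Longrightarrow> a + b \<in> R" "a \<in> R \<Longrightarrow> - a \<in> R" "a \<in> R \<Longrightarrow> a ^ k \<in> R"
proof -
  have R: "1 \<in> R" "\<And>a b. a \<in> R \<Longrightarrow> b \<in> R \<Longrightarrow> a - b \<in> R" "\<And>a b. a \<in> R \<Longrightarrow> b \<in> R \<Longrightarrow> a * b \<in> R"
    using assms by (auto simp: is_subring_def)
  then show "1 \<in> R" "a \<in> R \<Longrightarrow> b \<in> R \<Longrightarrow> a - b \<in> R" "a \<in> R \<Longrightarrow> b \<in> R \<Longrightarrow> a * b \<in> R" by auto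
  show z: "0 \<in> R" using R(2)[OF R(1) R(1)] by simp
  show u: "- a \<in> R" if "a \<in> R" for a using R(2)[OF z that] by simp
  show "a + b \<in> R" if "a \<in> R" "b \<in> R" using R(2)[OF that(1) u[OF that(2)]] by simp
  show "a ^ k \<in> R" if "a \<in> R" by (induction k) (use R that in auto)
qed

lemma is_subring_sum:
  "is_subring R \<Longrightarrow> (\<And>i. i \<in> I \<Longrightarrow> f i \<in> R) \<Longrightarrow> sum f I \<in> R"
  by (induction I rule: infinite_finite_induct) (auto intro: is_subringD)

lemma polys_over_closed:
  assumes R: "is_subring R"
  shows "0 \<in> polys_over R" "1 \<in> polys_over R" "[:0, 1:] \<in> polys_over R"
    "c \<in> R \<Longrightarrow> [:c:] \<in> polys_over R" "c \<in> R \<Longrightarrow> monom c k \<in> polys_over R"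
    "p \<in> polys_over R \<Longrightarrow> q \<in> polys_over R \<Longrightarrow> p + q \<in> polys_over R"
    "p \<in> polys_over R \<Longrightarrow> q \<in> polys_over R \<Longrightarrow> p - q \<in> polys_over R"
    "p \<in> polys_over R \<Longrightarrow> q \<in> polys_over R \<Longrightarrow> p * q \<in> polys_over R"
    "c \<in> R \<Longrightarrow> p \<in> polys_over R \<Longrightarrow> smult c p \<in> polys_over R"
  using is_subringD[OF R]
  by (auto simp: polys_over_def coeff_mult coeff_pCons split: nat.splits intro!: is_subring_sum[OF R])

lemma adjoin_subring: "is_subring R \<Longrightarrow> is_subring (adjoin R x)"
  unfolding is_subring_def[of "adjoin R x"]
proof (intro conjI ballI)
  assume R: "is_subring R"
  show "1 \<in> adjoin R x" unfolding adjoin_def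
    by (rule image_eqI[of _ _ 1]) (auto intro: polys_over_closed[OF R])
  fix a b assume "a \<in> adjoin R x" "b \<in> adjoin R x"
  then obtain p q where "a = poly p x" "b = poly q x" "p \<in> polys_over R" "q \<in> polys_over R"
    by (auto simp: adjoin_def)
  then show "a - b \<in> adjoin R x" "a * b \<in> adjoin R x"
    using polys_over_closed(7,8)[OF R] unfolding adjoin_def
    by (auto simp flip: poly_mult poly_diff)
qed

lemma subset_adjoin: "is_subring R \<Longrightarrow> R \<subseteq> adjoin R x"
  unfolding adjoin_def
  by (auto intro!: image_eqI[where x = "[:_:]"] polys_over_closed)

lemma gen_in_adjoin: "is_subring R \<Longrightarrow> x \<in> adjoin R x"
  unfolding adjoin_def by (rule image_eqI[of _ _ "[:0, 1:]"]) (auto intro: polys_over_closed)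

lemma adjoin_least:
  assumes "is_subring U" "R \<subseteq> U" "x \<in> U"
  shows "adjoin R x \<subseteq> U"
  using assms(2) unfolding adjoin_def
  by (auto simp: poly_altdef polys_over_def
      intro!: is_subring_sum[OF assms(1)] is_subringD(4,7)[OF assms(1)] assms(3))

section \<open>Pseudo-division and algebraic generators\<close>

lemma polys_over_pseudo_divide:
  assumes R: "is_subring R" and f: "f \<in> polys_over R" "f \<noteq> 0" and p: "p \<in> polys_over R"
  shows "\<exists>k. \<exists>q\<in>polys_over R. \<exists>r\<in>polys_over R.
    smult (lead_coeff f ^ k) p = q * f + r \<and> (r = 0 \<or> degree r < degree f)"
  using p
\<comment> \<open>The measure puts the zero polynomial below the constants, which
  \<open>degree\<close> alone does not. Multiplying by the leading coefficient of \<open>f\<close>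
  allows the top term of \<open>p\<close> to be cancelled without division.\<close>
proof (induction "if p = 0 then 0 else Suc (degree p)" arbitrary: p rule: less_induct)
  case (less p)
  show ?case
  proof (cases "p = 0 \<or> degree p < degree f")
    case True
    then show ?thesis
      by (intro exI[of _ 0] bexI[of _ 0] bexI[of _ p]) (use less polys_over_closed[OF R] in auto)
  next
    case False
    define c where "c = lead_coeff f"
    define m where "m = monom (lead_coeff p) (degree p - degree f)"
    define p' where "p' = smult c p - m * f"
    have cR: "c \<in> R" "lead_coeff p \<in> R" using f less by (auto simp: c_def polys_over_def)
    have mR: "m \<in> polys_over R" unfolding m_def using cR polys_over_closed[OF R] by auto
    have p'R: "p' \<in> polys_over R" unfolding p'_def using cR mR f less polys_over_closed[OF R] by auto
    have dm: "degree (m * f) \<le> degree p"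
      using degree_mult_le[of m f] degree_monom_le[of "lead_coeff p" "degree p - degree f"] False
      unfolding m_def by linarith
    have "degree p' \<le> degree p" unfolding p'_def
      by (intro degree_diff_le dm) (simp add: degree_smult_le)
    moreover have "coeff p' (degree p) = 0"
      using False coeff_monom_mult[of "lead_coeff p" "degree p - degree f" f "degree p"]
      by (simp add: p'_def m_def c_def mult.commute)
    ultimately have "p' = 0 \<or> degree p' < degree p"
      by (metis leading_coeff_0_iff nat_less_le)
    then have "(if p' = 0 then 0 else Suc (degree p')) < (if p = 0 then 0 else Suc (degree p))"
      using False by auto
    from less.hyps[OF this p'R] obtain k q r where
      *: "q \<in> polys_over R" "r \<in> polys_over R" "smult (c ^ k) p' = q * f + r"
        "r = 0 \<or> degree r < degree f" unfolding c_def by blast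
    have "smult (c ^ Suc k) p = smult (c ^ k) (p' + m * f)" unfolding p'_def
      by (simp add: mult.commute)
    also have "\<dots> = (q + smult (c ^ k) m) * f + r"
      using * by (simp add: smult_add_right algebra_simps)
    finally show ?thesis
      using * mR cR polys_over_closed[OF R] is_subringD[OF R] unfolding c_def
      by (intro exI[of _ "Suc k"] bexI[of _ "q + smult (c ^ k) m"] bexI[of _ r]) (auto simp: c_def)
  qed
qed

lemma zero_divisor_free_power:
  assumes "zero_divisor_free R" "is_subring R" "c \<in> R" "c \<noteq> 0" "(1::'a::comm_ring_1) \<noteq> 0"
  shows "(c::'a) ^ k \<noteq> 0"
proof (induction k)
  case (Suc k)
  then show ?case using assms is_subringD(7)[OF assms(2,3)] unfolding zero_divisor_free_def
    by (metis power_Suc)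
qed (use assms in auto)

lemma polys_over_smult_nonzero:
  assumes "zero_divisor_free R" "is_subring R" "c \<in> R" "c \<noteq> 0" "p \<in> polys_over R" "p \<noteq> 0"
  shows "smult c p \<noteq> 0"
proof
  assume "smult c p = 0"
  then have "c * lead_coeff p = 0" by (metis coeff_0 coeff_smult)
  then show False using assms unfolding zero_divisor_free_def polys_over_def
    by (metis leading_coeff_0_iff mem_Collect_eq)
qed

lemma polys_over_degree_mult:
  assumes "zero_divisor_free R" "is_subring R" "q \<in> polys_over R" "p \<in> polys_over R" "q \<noteq> 0" "p \<noteq> 0"
  shows "degree (q * p) = degree q + degree p"
proof (rule antisym[OF degree_mult_le])
  have "lead_coeff q * lead_coeff p \<noteq> 0"
    using assms unfolding zero_divisor_free_def polys_over_def
    by (metis leading_coeff_0_iff mem_Collect_eq)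
  then show "degree q + degree p \<le> degree (q * p)"
    by (intro le_degree) (simp add: coeff_mult_degree_sum)
qed

lemma zero_divisor_free_subset: "zero_divisor_free S \<Longrightarrow> R \<subseteq> S \<Longrightarrow> zero_divisor_free R"
  by (auto simp: zero_divisor_free_def)

lemma minimal_polynomial:
  assumes "algebraic_over R x"
  obtains f where "f \<in> polys_over R" "f \<noteq> 0" "poly f x = 0"
    "\<And>p. p \<in> polys_over R \<Longrightarrow> p \<noteq> 0 \<Longrightarrow> poly p x = 0 \<Longrightarrow> degree f \<le> degree p"
  using assms unfolding algebraic_over_def
  using ex_has_least_nat[of "\<lambda>p. p \<in> polys_over R \<and> p \<noteq> 0 \<and> poly p x = 0" _ degree]
  by metis

text \<open>The multiple of \<open>u\<close> is taken of minimal degree in \<open>x\<close>; pseudo-division of the minimal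
  polynomial of \<open>x\<close> by it shows that this degree is zero.\<close>

lemma algebraic_multiple_in_base:
  fixes x u :: "'a::comm_ring_1"
  assumes R: "is_subring R" and dom: "zero_divisor_free (adjoin R x)"
    and alg: "algebraic_over R x" and u: "u \<in> adjoin R x" "u \<noteq> 0"
  shows "\<exists>b\<in>adjoin R x. b * u \<in> R \<and> b * u \<noteq> 0"
proof -
  let ?S = "adjoin R x"
  have S: "is_subring ?S" using R by (rule adjoin_subring)
  have RS: "R \<subseteq> ?S" by (rule subset_adjoin[OF R])
  have domR: "zero_divisor_free R" using dom RS by (rule zero_divisor_free_subset)
  have one: "(1::'a) \<noteq> 0" using u(2) by (metis mult_1 mult_zero_left)
  obtain f where f: "f \<in> polys_over R" "f \<noteq> 0" "poly f x = 0"
    and fmin: "\<And>p. p \<in> polys_over R \<Longrightarrow> p \<noteq> 0 \<Longrightarrow> poly p x = 0 \<Longrightarrow> degree f \<le> degree p"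
    using minimal_polynomial[OF alg] by blast
  define W where "W = (\<lambda>p. p \<in> polys_over R \<and> poly p x \<noteq> 0 \<and> (\<exists>b\<in>?S. poly p x = b * u))"
  obtain p0 where p0: "W p0" using u is_subringD(1)[OF S] unfolding W_def adjoin_def
    by (metis (no_types, lifting) imageE mult_1)
  obtain p where p: "W p" and pmin: "\<And>q. W q \<Longrightarrow> degree p \<le> degree q"
    using p0 ex_has_least_nat[of W p0 degree] by blast
  then obtain b where b: "b \<in> ?S" "poly p x = b * u" and pR: "p \<in> polys_over R" and px: "poly p x \<noteq> 0"
    unfolding W_def by blast
  have pn0: "p \<noteq> 0" using px by auto
  have "degree p = 0"
  proof (rule ccontr)
    assume dp: "degree p \<noteq> 0"
    \<comment> \<open>The remainder of \<open>p\<close> modulo \<open>f\<close> still takes a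
      non-zero multiple of \<open>u\<close> as value at \<open>x\<close>, so minimality of
      \<open>p\<close> bounds its degree by that of a remainder below \<open>f\<close>. The bound
      later forces a remainder below \<open>p\<close> that kills \<open>x\<close> to be
      zero.\<close>
    have dpf: "degree p \<le> degree f"
    proof -
      obtain k q r where *: "q \<in> polys_over R" "r \<in> polys_over R"
        "smult (lead_coeff f ^ k) p = q * f + r" "r = 0 \<or> degree r < degree f"
        using polys_over_pseudo_divide[OF R f(1,2) pR] by blast
      have "poly r x = lead_coeff f ^ k * poly p x"
        using arg_cong[OF *(3), of "\<lambda>p. poly p x"] f by simp
      moreover have lc: "lead_coeff f ^ k \<in> R" "lead_coeff f ^ k \<noteq> 0"
        using f is_subringD(7)[OF R] zero_divisor_free_power[OF domR R _ _ one]
        by (auto simp: polys_over_def)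
      ultimately have "poly r x \<noteq> 0" and "poly r x = (lead_coeff f ^ k * b) * u"
        using px lc RS dom b S unfolding zero_divisor_free_def
        by (metis is_subringD(4) pR image_eqI adjoin_def subsetD, simp add: b mult.assoc)
      then have "W r" unfolding W_def using * lc RS b is_subringD(4)[OF S] by blast
      then have "degree p \<le> degree r" by (rule pmin)
      then show ?thesis using * \<open>poly r x \<noteq> 0\<close> by auto
    qed
    obtain k q r where *: "q \<in> polys_over R" "r \<in> polys_over R"
      "smult (lead_coeff p ^ k) f = q * p + r" "r = 0 \<or> degree r < degree p"
      using polys_over_pseudo_divide[OF R pR pn0 f(1)] by blast
    have "lead_coeff p ^ k * poly f x = poly q x * poly p x + poly r x"
      using arg_cong[OF *(3), of "\<lambda>p. poly p x"] by simp
    then have rx: "poly r x = - (poly q x * poly p x)" using f by (simp add: eq_neg_iff_add_eq_0 add.commute)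
    have "poly r x = 0"
    proof (rule ccontr)
      assume "poly r x \<noteq> 0"
      moreover have "poly q x \<in> ?S" using * by (auto simp: adjoin_def)
      then have "- (poly q x * b) \<in> ?S" using b by (intro is_subringD(4,6)[OF S])
      then have "\<exists>b\<in>?S. poly r x = b * u"
        by (rule bexI[rotated]) (use rx b in \<open>simp add: mult.assoc\<close>)
      ultimately have "degree p \<le> degree r" using * by (intro pmin) (auto simp: W_def)
      then show False using * \<open>poly r x \<noteq> 0\<close> by auto
    qed
    then have r0: "r = 0" using fmin[OF *(2)] *(4) dpf by (metis le_trans not_le)
    have qp: "smult (lead_coeff p ^ k) f = q * p" using * r0 by simp
    have lp: "lead_coeff p ^ k \<in> R" "lead_coeff p ^ k \<noteq> 0"
      using pR pn0 is_subringD(7)[OF R] zero_divisor_free_power[OF domR R _ _ one]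
      by (auto simp: polys_over_def)
    have nz: "smult (lead_coeff p ^ k) f \<noteq> 0"
      using polys_over_smult_nonzero[OF domR R lp f(1,2)] .
    then have q0: "q \<noteq> 0" using qp by auto
    \<comment> \<open>As \<open>poly p x\<close> is non-zero, the quotient \<open>q\<close> kills
      \<open>x\<close> and so has at least the degree of \<open>f\<close>; this leaves no room for a
      factor \<open>p\<close> of positive degree.\<close>
    have "poly q x * poly p x = 0" using rx \<open>poly r x = 0\<close> by simp
    then have "poly q x = 0" using dom px pR *(1) unfolding zero_divisor_free_def adjoin_def by blast
    then have "degree f \<le> degree q" using fmin *(1) q0 by blast
    moreover have "degree q + degree p \<le> degree f"
      using polys_over_degree_mult[OF domR R *(1) pR q0 pn0] qp degree_smult_le by metis
    ultimately show False using dp by simp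
  qed
  then obtain c where "p = [:c:]" using degree_eq_zeroE by blast
  then have "poly p x \<in> R" using pR by (auto simp: polys_over_def coeff_pCons split: nat.splits)
  then show ?thesis using b px by metis
qed

section \<open>Extension of homomorphisms to C\<close>

lemma ring_hom_onD:
  assumes "ring_hom_on R \<phi>" "is_subring R"
  shows "\<phi> 0 = 0" "\<phi> 1 = 1" "a \<in> R \<Longrightarrow> b \<in> R \<Longrightarrow> \<phi> (a + b) = \<phi> a + \<phi> b"
    "a \<in> R \<Longrightarrow> b \<in> R \<Longrightarrow> \<phi> (a * b) = \<phi> a * \<phi> b"
    "a \<in> R \<Longrightarrow> b \<in> R \<Longrightarrow> \<phi> (a - b) = \<phi> a - \<phi> b" "a \<in> R \<Longrightarrow> \<phi> (a ^ k) = \<phi> a ^ k"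
proof -
  have h: "\<phi> 1 = 1" "\<And>a b. a \<in> R \<Longrightarrow> b \<in> R \<Longrightarrow> \<phi> (a + b) = \<phi> a + \<phi> b"
    "\<And>a b. a \<in> R \<Longrightarrow> b \<in> R \<Longrightarrow> \<phi> (a * b) = \<phi> a * \<phi> b" using assms by (auto simp: ring_hom_on_def)
  then show "\<phi> 1 = 1" "a \<in> R \<Longrightarrow> b \<in> R \<Longrightarrow> \<phi> (a + b) = \<phi> a + \<phi> b"
    "a \<in> R \<Longrightarrow> b \<in> R \<Longrightarrow> \<phi> (a * b) = \<phi> a * \<phi> b" by auto
  show "\<phi> 0 = 0" using h(2)[of 0 0] is_subringD[OF assms(2)] by simp
  show "\<phi> (a - b) = \<phi> a - \<phi> b" if "a \<in> R" "b \<in> R"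
    using h(2)[of "a - b" b] that is_subringD(3)[OF assms(2)] by simp
  show "\<phi> (a ^ k) = \<phi> a ^ k" if "a \<in> R"
    by (induction k) (use h that is_subringD(7)[OF assms(2)] in auto)
qed

lemma ring_hom_on_sum:
  assumes "ring_hom_on R \<phi>" "is_subring R" "\<And>i. i \<in> I \<Longrightarrow> f i \<in> R"
  shows "\<phi> (sum f I) = (\<Sum>i\<in>I. \<phi> (f i))"
  using assms(3)
  by (induction I rule: infinite_finite_induct)
     (auto simp: ring_hom_onD[OF assms(1,2)] is_subring_sum[OF assms(2)])

lemma ring_hom_on_map_poly:
  assumes h: "ring_hom_on R \<phi>" and R: "is_subring R" and p: "p \<in> polys_over R" and q: "q \<in> polys_over R"
  shows "map_poly \<phi> (p + q) = map_poly \<phi> p + map_poly \<phi> q"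
    "map_poly \<phi> (p * q) = map_poly \<phi> p * map_poly \<phi> q"
    "map_poly \<phi> (p - q) = map_poly \<phi> p - map_poly \<phi> q"
proof -
  note H = ring_hom_onD[OF h R]
  have c: "coeff p i \<in> R" "coeff q i \<in> R" for i using p q by (auto simp: polys_over_def)
  show "map_poly \<phi> (p + q) = map_poly \<phi> p + map_poly \<phi> q"
    "map_poly \<phi> (p - q) = map_poly \<phi> p - map_poly \<phi> q"
    by (auto intro!: poly_eqI simp: coeff_map_poly H c)
  show "map_poly \<phi> (p * q) = map_poly \<phi> p * map_poly \<phi> q"
    by (auto intro!: poly_eqI sum.cong simp: coeff_map_poly H c coeff_mult
        ring_hom_on_sum[OF h R] is_subringD(4)[OF R])
qed

text \<open>A homomorphism on \<open>adjoin R x\<close> amounts to one on \<open>R\<close> together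
  with a value \<open>t\<close> for \<open>x\<close> that satisfies all relations of
  \<open>x\<close>; \<open>wd\<close> is this compatibility.\<close>

lemma evaluation_hom:
  assumes h: "ring_hom_on R \<phi>" and R: "is_subring R"
    and wd: "\<And>p. p \<in> polys_over R \<Longrightarrow> poly p x = 0 \<Longrightarrow> poly (map_poly \<phi> p) t = 0"
  obtains \<psi> where "ring_hom_on (adjoin R x) \<psi>" "\<And>a. a \<in> R \<Longrightarrow> \<psi> a = \<phi> a"
    "\<And>p. p \<in> polys_over R \<Longrightarrow> \<psi> (poly p x) = poly (map_poly \<phi> p) t"
proof -
  \<comment> \<open>Any polynomial representing \<open>s\<close> may be chosen: two choices differ
    by a relation of \<open>x\<close>, whose image vanishes at \<open>t\<close> by
    \<open>wd\<close>.\<close>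
  define \<psi> where "\<psi> = (\<lambda>s. poly (map_poly \<phi> (SOME p. p \<in> polys_over R \<and> poly p x = s)) t)"
  note C = polys_over_closed[OF R]
  have psi: "\<psi> (poly p x) = poly (map_poly \<phi> p) t" if p: "p \<in> polys_over R" for p
  proof -
    define q where "q = (SOME q. q \<in> polys_over R \<and> poly q x = poly p x)"
    have "q \<in> polys_over R \<and> poly q x = poly p x" unfolding q_def by (rule someI[of _ p]) (use p in auto)
    then have q: "q \<in> polys_over R" "poly q x = poly p x" by auto
    then have "poly (map_poly \<phi> (q - p)) t = 0" using p C by (intro wd) auto
    then show ?thesis unfolding \<psi>_def q_def[symmetric]
      using ring_hom_on_map_poly(3)[OF h R q(1) p] by simp
  qed
  have 1: "\<psi> a = \<phi> a" if "a \<in> R" for a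
    using psi[of "[:a:]"] that C ring_hom_onD(1)[OF h R] by (simp add: map_poly_pCons)
  have "ring_hom_on (adjoin R x) \<psi>"
    unfolding ring_hom_on_def adjoin_def
  proof (intro conjI ballI; (elim imageE)?)
    show "\<psi> 1 = 1" using 1[of 1] is_subringD(1)[OF R] ring_hom_onD(2)[OF h R] by simp
    fix a b p q assume *: "a = poly p x" "p \<in> polys_over R" "b = poly q x" "q \<in> polys_over R"
    show "\<psi> (a + b) = \<psi> a + \<psi> b" "\<psi> (a * b) = \<psi> a * \<psi> b"
      using psi[of "p + q"] psi[of "p * q"] * C psi ring_hom_on_map_poly[OF h R]
      by (simp_all flip: poly_add poly_mult)
  qed
  then show ?thesis using that 1 psi by blast
qed

lemma finite_roots_avoid:
  fixes p :: "complex poly"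
  assumes "p \<noteq> 0"
  obtains t where "poly p t \<noteq> 0"
  using assms poly_all_0_iff_0 by blast

text \<open>The one-generator case of Chevalley's theorem. For transcendental \<open>x\<close>,
  \<open>v\<close> is a non-zero coefficient of a polynomial representing \<open>u\<close>: its
  image under \<open>\<phi>\<close> is a non-zero polynomial, and \<open>x\<close> may be sent to
  any non-root. For algebraic \<open>x\<close>, \<open>v\<close> is the leading coefficient of a
  minimal polynomial, which guarantees a root after applying \<open>\<phi>\<close>, times a multiple
  of \<open>u\<close> lying in \<open>R\<close>, which keeps the image of \<open>u\<close> away from
  zero.\<close>

lemma ring_hom_extension:
  fixes x u :: "'a::comm_ring_1"
  assumes R: "is_subring R" and dom: "zero_divisor_free (adjoin R x)"
    and u: "u \<in> adjoin R x" "u \<noteq> 0"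
  shows "\<exists>v\<in>R. v \<noteq> 0 \<and> (\<forall>\<phi>. ring_hom_on R \<phi> \<and> \<phi> v \<noteq> 0 \<longrightarrow>
    (\<exists>\<psi>. ring_hom_on (adjoin R x) \<psi> \<and> (\<forall>a\<in>R. \<psi> a = \<phi> a) \<and> \<psi> u \<noteq> 0))"
proof (cases "algebraic_over R x")
  case False
  obtain p where p: "p \<in> polys_over R" "u = poly p x" using u by (auto simp: adjoin_def)
  then obtain i where i: "coeff p i \<noteq> 0" using u by (metis leading_coeff_0_iff poly_0)
  have "\<exists>\<psi>. ring_hom_on (adjoin R x) \<psi> \<and> (\<forall>a\<in>R. \<psi> a = \<phi> a) \<and> \<psi> u \<noteq> 0"
    if h: "ring_hom_on R \<phi>" and "\<phi> (coeff p i) \<noteq> 0" for \<phi>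
  proof -
    have "coeff (map_poly \<phi> p) i \<noteq> 0" using that ring_hom_onD(1)[OF h R] by (simp add: coeff_map_poly)
    then have "map_poly \<phi> p \<noteq> 0" by auto
    then obtain t where t: "poly (map_poly \<phi> p) t \<noteq> 0" by (rule finite_roots_avoid)
    have "poly (map_poly \<phi> q) t = 0" if "q \<in> polys_over R" "poly q x = 0" for q
      using False that unfolding algebraic_over_def by force
    from evaluation_hom[OF h R this] obtain \<psi> where "ring_hom_on (adjoin R x) \<psi>" "\<And>a. a \<in> R \<Longrightarrow> \<psi> a = \<phi> a"
      "\<And>p. p \<in> polys_over R \<Longrightarrow> \<psi> (poly p x) = poly (map_poly \<phi> p) t" by blast
    then show ?thesis using t p by auto
  qed
  then show ?thesis using i p by (intro bexI[of _ "coeff p i"]) (auto simp: polys_over_def)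
next
  case True
  obtain f where f: "f \<in> polys_over R" "f \<noteq> 0" "poly f x = 0"
    and fmin: "\<And>p. p \<in> polys_over R \<Longrightarrow> p \<noteq> 0 \<Longrightarrow> poly p x = 0 \<Longrightarrow> degree f \<le> degree p"
    using minimal_polynomial[OF True] by blast
  obtain b where b: "b \<in> adjoin R x" "b * u \<in> R" "b * u \<noteq> 0"
    using algebraic_multiple_in_base[OF R dom True u] by blast
  define c where "c = lead_coeff f"
  have domR: "zero_divisor_free R" by (rule zero_divisor_free_subset[OF dom subset_adjoin[OF R]])
  have c: "c \<in> R" "c \<noteq> 0" using f by (auto simp: c_def polys_over_def)
  have "c * (b * u) \<noteq> 0" using domR b c by (auto simp: zero_divisor_free_def)
  moreover have "\<exists>\<psi>. ring_hom_on (adjoin R x) \<psi> \<and> (\<forall>a\<in>R. \<psi> a = \<phi> a) \<and> \<psi> u \<noteq> 0"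
    if h: "ring_hom_on R \<phi>" and nz: "\<phi> (c * (b * u)) \<noteq> 0" for \<phi>
  proof -
    note H = ring_hom_onD[OF h R]
    have fc: "\<phi> c \<noteq> 0" "\<phi> (b * u) \<noteq> 0" using nz c b H by auto
    have "degree f \<noteq> 0"
    proof
      assume "degree f = 0"
      then obtain a where "f = [:a:]" using degree_eq_zeroE by blast
      then show False using f by auto
    qed
    moreover have "degree f \<le> degree (map_poly \<phi> f)"
      by (rule le_degree) (use fc H in \<open>simp add: coeff_map_poly c_def\<close>)
    ultimately have "\<not> constant (poly (map_poly \<phi> f))" by (simp add: constant_degree)
    then obtain t where t: "poly (map_poly \<phi> f) t = 0"
      using fundamental_theorem_of_algebra by blast
    \<comment> \<open>Pseudo-division makes \<open>c ^ k\<close> times a relation \<open>p\<close> a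
      multiple of \<open>f\<close>, because the remainder is a relation of too small degree;
      \<open>\<phi> c\<close> is non-zero and can be cancelled.\<close>
    have "poly (map_poly \<phi> p) t = 0" if p: "p \<in> polys_over R" "poly p x = 0" for p
    proof -
      obtain k q r where *: "q \<in> polys_over R" "r \<in> polys_over R"
        "smult (c ^ k) p = q * f + r" "r = 0 \<or> degree r < degree f"
        using polys_over_pseudo_divide[OF R f(1,2) p(1)] unfolding c_def by blast
      have "poly r x = 0" using arg_cong[OF *(3), of "\<lambda>p. poly p x"] f p by simp
      then have "r = 0" using fmin[OF *(2)] *(4) by (metis not_le)
      then have "[:c ^ k:] * p = q * f" using * by simp
      moreover have "[:c ^ k:] \<in> polys_over R" using c R by (auto intro!: polys_over_closed is_subringD(7))
      ultimately have "map_poly \<phi> [:c ^ k:] * map_poly \<phi> p = map_poly \<phi> q * map_poly \<phi> f"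
        using ring_hom_on_map_poly(2)[OF h R] p *(1) f by metis
      then have "poly (map_poly \<phi> [:c ^ k:]) t * poly (map_poly \<phi> p) t = 0"
        using t by (metis mult_zero_right poly_mult)
      then show ?thesis using H c fc by (auto simp: map_poly_pCons)
    qed
    from evaluation_hom[OF h R this] obtain \<psi> where
      psi: "ring_hom_on (adjoin R x) \<psi>" "\<And>a. a \<in> R \<Longrightarrow> \<psi> a = \<phi> a" by blast
    have "\<psi> b * \<psi> u = \<phi> (b * u)"
      using psi b u ring_hom_onD(4)[OF psi(1) adjoin_subring[OF R]] by metis
    then have "\<psi> u \<noteq> 0" using fc by auto
    then show ?thesis using psi by blast
  qed
  ultimately show ?thesis using b c is_subringD(4)[OF R] by blast
qed

section \<open>Finitely many generators\<close>

fun adjoin_list :: "'a::comm_ring_1 set \<Rightarrow> 'a list \<Rightarrow> 'a set" where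
  "adjoin_list R [] = R"
| "adjoin_list R (x # xs) = adjoin_list (adjoin R x) xs"

lemma adjoin_list_props:
  assumes "is_subring R"
  shows "is_subring (adjoin_list R xs) \<and> R \<subseteq> adjoin_list R xs \<and> set xs \<subseteq> adjoin_list R xs"
  using assms
proof (induction xs arbitrary: R)
  case (Cons x xs)
  note A = adjoin_subring[OF Cons.prems, of x]
  show ?case
    using Cons.IH[OF A] subset_adjoin[OF Cons.prems, of x] gen_in_adjoin[OF Cons.prems, of x] by auto
qed auto

lemma adjoin_list_least:
  "is_subring U \<Longrightarrow> R \<subseteq> U \<Longrightarrow> set xs \<subseteq> U \<Longrightarrow> adjoin_list R xs \<subseteq> U"
proof (induction xs arbitrary: R)
  case (Cons x xs)
  then show ?case using adjoin_least[of U R x] by simp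
qed auto

lemma algebraic_over_mono: "algebraic_over R x \<Longrightarrow> R \<subseteq> R' \<Longrightarrow> algebraic_over R' x"
  unfolding algebraic_over_def polys_over_def by blast

text \<open>Generators are cleared one at a time: the tail of the list yields a multiple in
  \<open>adjoin R x\<close>, and the one-generator lemma moves it down to \<open>R\<close>.\<close>

lemma algebraic_list_multiple_in_base:
  assumes "is_subring R" "zero_divisor_free (adjoin_list R xs)"
    "\<And>x. x \<in> set xs \<Longrightarrow> algebraic_over R x" "u \<in> adjoin_list R xs" "u \<noteq> 0"
  shows "\<exists>b\<in>adjoin_list R xs. b * u \<in> R \<and> b * u \<noteq> 0"
  using assms
proof (induction xs arbitrary: R)
  case Nil
  then show ?case by (auto intro!: bexI[of _ 1] is_subringD)
next
  case (Cons x xs)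
  let ?R = "adjoin R x" and ?S = "adjoin_list R (x # xs)"
  have R': "is_subring ?R" by (rule adjoin_subring[OF Cons.prems(1)])
  have RS: "?R \<subseteq> ?S" using adjoin_list_props[OF R'] by simp
  have S: "is_subring ?S" using adjoin_list_props[OF R'] by simp
  obtain b where b: "b \<in> ?S" "b * u \<in> ?R" "b * u \<noteq> 0"
    using Cons.IH[OF R'] Cons.prems algebraic_over_mono[OF _ subset_adjoin[OF Cons.prems(1)]]
    by auto
  obtain b' where b': "b' \<in> ?R" "b' * (b * u) \<in> R" "b' * (b * u) \<noteq> 0"
    using algebraic_multiple_in_base[OF Cons.prems(1) zero_divisor_free_subset[OF Cons.prems(2) RS] _ b(2,3)]
      Cons.prems(3) by auto
  show ?case
    by (rule bexI[of _ "b' * b"]) (use b b' RS is_subringD(4)[OF S] in \<open>auto simp: mult.assoc\<close>)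
qed

text \<open>The element \<open>v\<close> that the tail of the list demands to be non-zero becomes
  the element that the extension by the first generator must preserve; this is why the one-generator
  lemma allows an arbitrary \<open>u\<close>.\<close>

lemma ring_hom_list_extension:
  assumes "is_subring R" "zero_divisor_free (adjoin_list R xs)" "u \<in> adjoin_list R xs" "u \<noteq> 0"
  shows "\<exists>v\<in>R. v \<noteq> 0 \<and> (\<forall>\<phi>. ring_hom_on R \<phi> \<and> \<phi> v \<noteq> 0 \<longrightarrow>
    (\<exists>\<psi>. ring_hom_on (adjoin_list R xs) \<psi> \<and> (\<forall>a\<in>R. \<psi> a = \<phi> a) \<and> \<psi> u \<noteq> 0))"
  using assms
proof (induction xs arbitrary: R)
  case Nil
  then show ?case by auto
next
  case (Cons x xs)
  let ?R = "adjoin R x" and ?S = "adjoin_list R (x # xs)"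
  have R': "is_subring ?R" by (rule adjoin_subring[OF Cons.prems(1)])
  have RS: "?R \<subseteq> ?S" using adjoin_list_props[OF R'] by simp
  obtain v where v: "v \<in> ?R" "v \<noteq> 0" and ext: "\<And>\<phi>. ring_hom_on ?R \<phi> \<Longrightarrow> \<phi> v \<noteq> 0 \<Longrightarrow>
    (\<exists>\<psi>. ring_hom_on ?S \<psi> \<and> (\<forall>a\<in>?R. \<psi> a = \<phi> a) \<and> \<psi> u \<noteq> 0)"
    using Cons.IH[OF R'] Cons.prems by auto
  obtain w where w: "w \<in> R" "w \<noteq> 0" and ext': "\<And>\<phi>. ring_hom_on R \<phi> \<Longrightarrow> \<phi> w \<noteq> 0 \<Longrightarrow>
    (\<exists>\<psi>. ring_hom_on ?R \<psi> \<and> (\<forall>a\<in>R. \<psi> a = \<phi> a) \<and> \<psi> v \<noteq> 0)"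
    using ring_hom_extension[OF Cons.prems(1) zero_divisor_free_subset[OF Cons.prems(2) RS] v] by blast
  have "\<exists>\<psi>. ring_hom_on ?S \<psi> \<and> (\<forall>a\<in>R. \<psi> a = \<phi> a) \<and> \<psi> u \<noteq> 0"
    if \<phi>: "ring_hom_on R \<phi>" "\<phi> w \<noteq> 0" for \<phi>
  proof -
    obtain \<psi>1 where 1: "ring_hom_on ?R \<psi>1" "\<forall>a\<in>R. \<psi>1 a = \<phi> a" "\<psi>1 v \<noteq> 0" using ext'[OF \<phi>] by blast
    obtain \<psi> where "ring_hom_on ?S \<psi>" "\<forall>a\<in>?R. \<psi> a = \<psi>1 a" "\<psi> u \<noteq> 0" using ext[OF 1(1,3)] by blast
    then show ?thesis using 1 subset_adjoin[OF Cons.prems(1), of x] by (intro exI[of _ \<psi>]) auto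
  qed
  then show ?case using w by blast
qed

section \<open>Transcendence degree of a parametrised set\<close>

inductive_set poly_in :: "'t set \<Rightarrow> (('t \<Rightarrow> complex) \<Rightarrow> complex) set" for I :: "'t set" where
  const: "(\<lambda>_. c) \<in> poly_in I"
| coord: "t \<in> I \<Longrightarrow> (\<lambda>f. f t) \<in> poly_in I"
| add: "p \<in> poly_in I \<Longrightarrow> q \<in> poly_in I \<Longrightarrow> (\<lambda>f. p f + q f) \<in> poly_in I"
| mult: "p \<in> poly_in I \<Longrightarrow> q \<in> poly_in I \<Longrightarrow> (\<lambda>f. p f * q f) \<in> poly_in I"

text \<open>The coordinate ring of the closure of the image of \<open>\<pi>\<close>, in the
  coordinates \<open>I\<close>, realised as functions of the parameter.\<close>

definition pullback :: "('m \<Rightarrow> 't \<Rightarrow> complex) \<Rightarrow> 't set \<Rightarrow> ('m \<Rightarrow> complex) set" where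
  "pullback \<pi> I = (\<lambda>p. p \<circ> \<pi>) ` poly_in I"

text \<open>Polynomials appear as functions. Over the infinite field C only the zero polynomial
  gives the zero function, so this is the usual algebraic independence.\<close>

definition alg_indep :: "('m \<Rightarrow> 't \<Rightarrow> complex) \<Rightarrow> 't set \<Rightarrow> bool" where
  "alg_indep \<pi> I \<longleftrightarrow> (\<forall>p\<in>poly_in I. p \<circ> \<pi> = 0 \<longrightarrow> p = 0)"

text \<open>Only subsets of the given generators are compared. Generators of a domain contain a
  transcendence basis, so for a pullback ring without zero divisors this is the transcendence
  degree.\<close>

definition trdeg :: "('m \<Rightarrow> 't \<Rightarrow> complex) \<Rightarrow> 't set \<Rightarrow> nat" where
  "trdeg \<pi> T = Max {card I | I. I \<subseteq> T \<and> alg_indep \<pi> I}"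

lemma poly_in_mono: "I \<subseteq> J \<Longrightarrow> poly_in I \<subseteq> poly_in J"
proof
  fix p :: "('a \<Rightarrow> complex) \<Rightarrow> complex"
  assume "p \<in> poly_in I" and "I \<subseteq> J"
  then show "p \<in> poly_in J" by induction (auto intro: poly_in.intros)
qed

lemma pullback_subring: "is_subring (pullback \<pi> I)"
  unfolding is_subring_def pullback_def
proof (intro conjI ballI; (elim imageE)?)
  show "1 \<in> (\<lambda>p. p \<circ> \<pi>) ` poly_in I"
    by (rule image_eqI[OF _ poly_in.const[of 1]]) (auto simp: fun_eq_iff)
  fix a b p q assume *: "a = p \<circ> \<pi>" "b = q \<circ> \<pi>" "p \<in> poly_in I" "q \<in> poly_in I"
  show "a * b \<in> (\<lambda>p. p \<circ> \<pi>) ` poly_in I"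
    by (rule image_eqI[OF _ poly_in.mult[OF *(3,4)]]) (auto simp: fun_eq_iff *)
  show "a - b \<in> (\<lambda>p. p \<circ> \<pi>) ` poly_in I"
    by (rule image_eqI[OF _ poly_in.add[OF *(3) poly_in.mult[OF poly_in.const[of "- 1"] *(4)]]])
       (auto simp: fun_eq_iff *)
qed

lemma pullback_least:
  assumes U: "is_subring U" "\<And>c. (\<lambda>_. c) \<in> U" "\<And>t. t \<in> I \<Longrightarrow> (\<lambda>m. \<pi> m t) \<in> U"
  shows "pullback \<pi> I \<subseteq> U"
proof -
  have "p \<circ> \<pi> \<in> U" if "p \<in> poly_in I" for p
    using that
  proof induction
    case (add p q)
    then show ?case using is_subringD(5)[OF U(1), of "p \<circ> \<pi>" "q \<circ> \<pi>"] by (simp add: o_def plus_fun_def)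
  next
    case (mult p q)
    then show ?case using is_subringD(4)[OF U(1), of "p \<circ> \<pi>" "q \<circ> \<pi>"] by (simp add: o_def times_fun_def)
  qed (use U in \<open>auto simp: o_def\<close>)
  then show ?thesis by (auto simp: pullback_def)
qed

lemma const_in_pullback: "(\<lambda>_. c) \<in> pullback \<pi> I"
  unfolding pullback_def by (rule image_eqI[OF _ poly_in.const[of c]]) auto

lemma coord_in_pullback: "t \<in> I \<Longrightarrow> (\<lambda>m. \<pi> m t) \<in> pullback \<pi> I"
  unfolding pullback_def by (rule image_eqI[OF _ poly_in.coord[of t]]) (auto simp: o_def)

lemma pullback_mono: "I \<subseteq> J \<Longrightarrow> pullback \<pi> I \<subseteq> pullback \<pi> J"
  unfolding pullback_def using poly_in_mono by blast

lemma pullback_id: "pullback id I = poly_in I"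
  by (auto simp: pullback_def)

lemma poly_in_empty: "p \<in> poly_in {} \<Longrightarrow> \<exists>c. p = (\<lambda>_. c)"
proof (induction rule: poly_in.induct)
  case (add p q)
  then obtain c d where "p = (\<lambda>_. c)" "q = (\<lambda>_. d)" by blast
  then show ?case by (intro exI[of _ "c + d"]) simp
next
  case (mult p q)
  then obtain c d where "p = (\<lambda>_. c)" "q = (\<lambda>_. d)" by blast
  then show ?case by (intro exI[of _ "c * d"]) simp
qed auto

lemma alg_indep_empty: "alg_indep \<pi> {}"
  unfolding alg_indep_def using poly_in_empty by (fastforce simp: fun_eq_iff)

lemma poly_comp:
  fixes \<pi> :: "'m \<Rightarrow> 'k" and P :: "('k \<Rightarrow> complex) poly"
  shows "poly P x \<circ> \<pi> = poly (map_poly (\<lambda>q. q \<circ> \<pi>) P) (x \<circ> \<pi>)"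
proof (induction P)
  case 0
  then show ?case by (simp add: fun_eq_iff)
next
  case (pCons a P)
  have "poly (pCons a P) x \<circ> \<pi> = (a \<circ> \<pi>) + (x \<circ> \<pi>) * (poly P x \<circ> \<pi>)"
    by (simp add: fun_eq_iff)
  moreover have "(0 :: 'k \<Rightarrow> complex) \<circ> \<pi> = 0" by (simp add: fun_eq_iff)
  then have "map_poly (\<lambda>q. q \<circ> \<pi>) (pCons a P) = pCons (a \<circ> \<pi>) (map_poly (\<lambda>q. q \<circ> \<pi>) P)"
    using pCons(1) by (intro map_poly_pCons) auto
  ultimately show ?case using pCons(2) by (simp only: poly_pCons)
qed

text \<open>A relation for \<open>insert t I\<close> is read as a polynomial in the coordinate
  \<open>t\<close> over the polynomials in the other coordinates. Independence of \<open>I\<close>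
  keeps its leading coefficient non-zero after composition with \<open>\<pi>\<close>.\<close>

lemma algebraic_coordinate:
  fixes \<pi> :: "'m \<Rightarrow> 't \<Rightarrow> complex"
  assumes ind: "alg_indep \<pi> I" and dep: "\<not> alg_indep \<pi> (insert t I)"
  shows "algebraic_over (pullback \<pi> I) (\<lambda>m. \<pi> m t)"
proof -
  obtain p where p: "p \<in> poly_in (insert t I)" "p \<circ> \<pi> = 0" "p \<noteq> 0"
    using dep unfolding alg_indep_def by blast
  \<comment> \<open>With \<open>id\<close> as the parametrisation, the pullback ring is the
    polynomial ring itself.\<close>
  note R = pullback_subring[of id I]
  have "pullback id (insert t I) \<subseteq> adjoin (pullback id I) (\<lambda>f. f t)"
    using subset_adjoin[OF R, of "\<lambda>f. f t"] gen_in_adjoin[OF R, of "\<lambda>f. f t"]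
      const_in_pullback[of _ id I] coord_in_pullback[of _ I id]
    by (intro pullback_least adjoin_subring[OF R]) auto
  then obtain P where P: "P \<in> polys_over (poly_in I)" "p = poly P (\<lambda>f. f t)"
    using p unfolding pullback_id adjoin_def by blast
  let ?Q = "map_poly (\<lambda>q. q \<circ> \<pi>) P"
  have z: "(0 :: ('t \<Rightarrow> complex) \<Rightarrow> complex) \<circ> \<pi> = 0" by (simp add: fun_eq_iff)
  have "P \<noteq> 0" using p P by auto
  then have "lead_coeff P \<circ> \<pi> \<noteq> 0"
    using ind P unfolding alg_indep_def polys_over_def by auto
  then have "coeff ?Q (degree P) \<noteq> 0" using z by (simp add: coeff_map_poly)
  then have "?Q \<noteq> 0" by auto
  moreover have "?Q \<in> polys_over (pullback \<pi> I)"
    using P z by (auto simp: polys_over_def coeff_map_poly pullback_def)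
  moreover have "poly ?Q (\<lambda>m. \<pi> m t) = 0"
    using poly_comp[of P "\<lambda>f. f t" \<pi>] P p by (simp add: o_def)
  ultimately show ?thesis unfolding algebraic_over_def by blast
qed

section \<open>Transcendence degree under specialisation\<close>

lemma trdeg_set:
  assumes "finite T"
  shows "finite {card I | I. I \<subseteq> T \<and> alg_indep \<pi> I}" "{card I | I. I \<subseteq> T \<and> alg_indep \<pi> I} \<noteq> {}"
  using assms alg_indep_empty by auto

lemma card_le_trdeg: "finite T \<Longrightarrow> I \<subseteq> T \<Longrightarrow> alg_indep \<pi> I \<Longrightarrow> card I \<le> trdeg \<pi> T"
  unfolding trdeg_def by (rule Max_ge[OF trdeg_set(1)]) auto

lemma trdeg_attained:
  assumes "finite T"
  obtains I where "I \<subseteq> T" "alg_indep \<pi> I" "card I = trdeg \<pi> T"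
  using Max_in[OF trdeg_set[OF assms, of \<pi>]] unfolding trdeg_def[symmetric] by auto

lemma trdeg_le_card:
  assumes "finite T"
  shows "trdeg \<pi> T \<le> card T"
  using trdeg_attained[OF assms] card_mono[OF assms] by metis

text \<open>The hypothesis \<open>spec\<close> says that the image of \<open>\<sigma>\<close> lies
  in the closure of that of \<open>\<pi>\<close>. Relations pass from \<open>\<pi>\<close> to
  \<open>\<sigma>\<close>, hence independence passes back.\<close>

lemma alg_indep_specialization:
  assumes spec: "\<And>p. p \<in> poly_in T \<Longrightarrow> p \<circ> \<pi> = 0 \<Longrightarrow> p \<circ> \<sigma> = 0"
    and "I \<subseteq> T" "alg_indep \<sigma> I"
  shows "alg_indep \<pi> I"
  using assms poly_in_mono[OF assms(2)] unfolding alg_indep_def by blast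

lemma trdeg_mono:
  assumes "finite T" "\<And>p. p \<in> poly_in T \<Longrightarrow> p \<circ> \<pi> = 0 \<Longrightarrow> p \<circ> \<sigma> = 0"
  shows "trdeg \<sigma> T \<le> trdeg \<pi> T"
  using trdeg_attained[OF assms(1), of \<sigma>] alg_indep_specialization[OF assms(2)]
    card_le_trdeg[OF assms(1)] by metis

text \<open>A function vanishing on the specialisation but not on the original set has a nonzero multiple
  that is a polynomial in a transcendence basis; if that basis stays independent under
  specialisation, this is impossible.\<close>

lemma trdeg_strict:
  fixes \<pi> :: "'m \<Rightarrow> 't \<Rightarrow> complex" and \<sigma> :: "'k \<Rightarrow> 't \<Rightarrow> complex"
  assumes T: "finite T" and dom: "zero_divisor_free (pullback \<pi> T)"
    and spec: "\<And>p. p \<in> poly_in T \<Longrightarrow> p \<circ> \<pi> = 0 \<Longrightarrow> p \<circ> \<sigma> = 0"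
    and eq: "trdeg \<sigma> T = trdeg \<pi> T"
    and p: "p \<in> poly_in T" "p \<circ> \<sigma> = 0"
  shows "p \<circ> \<pi> = 0"
proof (rule ccontr)
  assume nz: "p \<circ> \<pi> \<noteq> 0"
  obtain I where I: "I \<subseteq> T" "alg_indep \<sigma> I" "card I = trdeg \<sigma> T"
    using trdeg_attained[OF T] by blast
  have ind: "alg_indep \<pi> I" by (rule alg_indep_specialization[OF spec I(1,2)])
  let ?R = "pullback \<pi> I"
  have R: "is_subring ?R" by (rule pullback_subring)
  obtain ts where ts: "set ts = T - I" using T finite_list by blast
  define xs where "xs = map (\<lambda>t m. \<pi> m t) ts"
  have alg: "algebraic_over ?R x" if x: "x \<in> set xs" for x
  proof -
    obtain t where t: "t \<in> T - I" "x = (\<lambda>m. \<pi> m t)" using x ts by (auto simp: xs_def)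
    have "finite I" using I(1) T finite_subset by blast
    \<comment> \<open>Equality of the degrees enters here: a basis for \<open>\<sigma>\<close>
      already has the largest size possible for \<open>\<pi>\<close>, so every further coordinate is
      algebraic over it.\<close>
    then have "card (insert t I) > trdeg \<pi> T" using I eq t by auto
    then have "\<not> alg_indep \<pi> (insert t I)"
      using card_le_trdeg[OF T, of "insert t I" \<pi>] t I by force
    then show ?thesis using algebraic_coordinate[OF ind] t by blast
  qed
  note props = adjoin_list_props[OF R, of xs]
  have "pullback \<pi> T \<subseteq> adjoin_list ?R xs"
  proof (rule pullback_least)
    fix t assume "t \<in> T"
    then show "(\<lambda>m. \<pi> m t) \<in> adjoin_list ?R xs"
      using props ts coord_in_pullback[of t I \<pi>] by (cases "t \<in> I") (auto simp: xs_def)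
  qed (use props const_in_pullback[of _ \<pi> I] in auto)
  moreover have "adjoin_list ?R xs \<subseteq> pullback \<pi> T"
    using coord_in_pullback[of _ T \<pi>] ts pullback_mono[OF I(1)]
    by (intro adjoin_list_least pullback_subring) (auto simp: xs_def)
  ultimately have S: "adjoin_list ?R xs = pullback \<pi> T" by blast
  have "p \<circ> \<pi> \<in> pullback \<pi> T" using p by (simp add: pullback_def)
  then have "\<exists>b\<in>adjoin_list ?R xs. b * (p \<circ> \<pi>) \<in> ?R \<and> b * (p \<circ> \<pi>) \<noteq> 0"
    by (intro algebraic_list_multiple_in_base[OF R _ alg _ nz]) (simp_all add: S dom)
  then obtain b where b: "b \<in> pullback \<pi> T" "b * (p \<circ> \<pi>) \<in> ?R" "b * (p \<circ> \<pi>) \<noteq> 0"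
    unfolding S by blast
  then obtain q r where q: "q \<in> poly_in T" "b = q \<circ> \<pi>" and r: "r \<in> poly_in I" "b * (p \<circ> \<pi>) = r \<circ> \<pi>"
    unfolding pullback_def by blast
  have rT: "r \<in> poly_in T" using r poly_in_mono[OF I(1)] by blast
  \<comment> \<open>That \<open>r\<close> equals \<open>q\<close> times \<open>p\<close> along
    \<open>\<pi>\<close> is a polynomial relation, so it also holds along \<open>\<sigma>\<close>,
    where \<open>p\<close> vanishes.\<close>
  have "(\<lambda>f. r f + (\<lambda>_. - 1) f * (q f * p f)) \<in> poly_in T"
    by (rule poly_in.add[OF rT poly_in.mult[OF poly_in.const poly_in.mult[OF q(1) p(1)]]])
  then have "(\<lambda>f. r f + (\<lambda>_. - 1) f * (q f * p f)) \<circ> \<sigma> = 0"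
    by (rule spec) (use r q in \<open>simp add: fun_eq_iff\<close>)
  then have "r \<circ> \<sigma> = 0" using p by (simp add: fun_eq_iff)
  then have "r = 0" using I r unfolding alg_indep_def by blast
  then show False using r b by (simp add: fun_eq_iff)
qed

section \<open>Structure constants and orbits\<close>

definition idx :: "nat \<Rightarrow> (nat \<times> nat \<times> nat) set" where
  "idx n = {..<n} \<times> {..<n} \<times> {..<n}"

definition sc :: "nat \<Rightarrow> mult \<Rightarrow> nat \<times> nat \<times> nat \<Rightarrow> complex" where
  "sc n A = (\<lambda>(i, j, k). A (unit_vec n i) (unit_vec n j) $ k)"

text \<open>Carrying the inverse as a second component makes the structure constants of a
  transported algebra polynomial in the parameters.\<close>

definition GL_pairs :: "nat \<Rightarrow> (complex mat \<times> complex mat) set" where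
  "GL_pairs n = {(g, h). g \<in> carrier_mat n n \<and> h \<in> carrier_mat n n \<and> g * h = 1\<^sub>m n \<and> h * g = 1\<^sub>m n}"

definition transport :: "mult \<Rightarrow> complex mat \<times> complex mat \<Rightarrow> mult" where
  "transport A = (\<lambda>(g, h) x y. g *\<^sub>v A (h *\<^sub>v x) (h *\<^sub>v y))"

lemma finite_idx: "finite (idx n)"
  by (simp add: idx_def)

lemma algebrasD:
  assumes "A \<in> algebras n" "x \<in> carrier_vec n" "y \<in> carrier_vec n"
  shows "A x y \<in> carrier_vec n" "dim_vec (A x y) = n"
    "x' \<in> carrier_vec n \<Longrightarrow> A (x + x') y = A x y + A x' y"
    "y' \<in> carrier_vec n \<Longrightarrow> A x (y + y') = A x y + A x y'"
    "A (c \<cdot>\<^sub>v x) y = c \<cdot>\<^sub>v A x y" "A x (c \<cdot>\<^sub>v y) = c \<cdot>\<^sub>v A x y"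
proof -
  show "A x y \<in> carrier_vec n" using assms by (simp add: algebras_def)
  then show "dim_vec (A x y) = n" by auto
qed (use assms in \<open>simp_all add: algebras_def\<close>)

lemma linear_expand:
  fixes f :: "complex vec \<Rightarrow> complex vec"
  assumes car: "\<And>x. x \<in> carrier_vec n \<Longrightarrow> f x \<in> carrier_vec n"
    and add: "\<And>x y. x \<in> carrier_vec n \<Longrightarrow> y \<in> carrier_vec n \<Longrightarrow> f (x + y) = f x + f y"
    and smult: "\<And>c x. x \<in> carrier_vec n \<Longrightarrow> f (c \<cdot>\<^sub>v x) = c \<cdot>\<^sub>v f x"
    and x: "x \<in> carrier_vec n" and k: "k < n"
  shows "f x $ k = (\<Sum>i<n. x $ i * f (unit_vec n i) $ k)"
proof -
  \<comment> \<open>\<open>X m\<close> keeps the first \<open>m\<close> coordinates of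
    \<open>x\<close>, so that induction on \<open>m\<close> adds one basis vector at a time.\<close>
  define X where "X m = vec n (\<lambda>i. if i < m then x $ i else 0)" for m
  have X: "X m \<in> carrier_vec n" for m by (simp add: X_def)
  have "f (X m) $ k = (\<Sum>i<m. x $ i * f (unit_vec n i) $ k)" if "m \<le> n" for m
    using that
  proof (induction m)
    case 0
    have "X 0 = 0 \<cdot>\<^sub>v X 0" by (auto simp: X_def)
    then have "f (X 0) = 0 \<cdot>\<^sub>v f (X 0)" using smult X by metis
    then have "f (X 0) $ k = (0 \<cdot>\<^sub>v f (X 0)) $ k" by simp
    then show ?case using car[OF X[of 0]] k by auto
  next
    case (Suc m)
    have "X (Suc m) = X m + x $ m \<cdot>\<^sub>v unit_vec n m"
      using Suc.prems by (auto simp: X_def less_Suc_eq)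
    then have "f (X (Suc m)) = f (X m) + x $ m \<cdot>\<^sub>v f (unit_vec n m)"
      using add smult X by (metis smult_carrier_vec unit_vec_carrier)
    then show ?case using Suc k car[of "unit_vec n m"] car[OF X, of m] by auto
  qed
  moreover have "X n = x" using x by (auto simp: X_def)
  ultimately show ?thesis by (metis order_refl)
qed

lemma algebra_expand:
  assumes A: "A \<in> algebras n" and x: "x \<in> carrier_vec n" and y: "y \<in> carrier_vec n" and k: "k < n"
  shows "A x y $ k = (\<Sum>i<n. \<Sum>j<n. x $ i * y $ j * sc n A (i, j, k))"
proof -
  note D = algebrasD[OF A]
  have "A x y $ k = (\<Sum>i<n. x $ i * A (unit_vec n i) y $ k)"
    by (rule linear_expand[of n "\<lambda>x. A x y"]) (use D x y k in auto)
  also have "\<dots> = (\<Sum>i<n. x $ i * (\<Sum>j<n. y $ j * A (unit_vec n i) (unit_vec n j) $ k))"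
    using linear_expand[of n "A (unit_vec n _)" y k] D y k by simp
  finally show ?thesis by (simp add: sc_def sum_distrib_left mult.assoc)
qed

lemma algebra_eqI:
  assumes A: "A \<in> algebras n" and B: "B \<in> algebras n" and eq: "\<And>t. t \<in> idx n \<Longrightarrow> sc n A t = sc n B t"
    and x: "x \<in> carrier_vec n" and y: "y \<in> carrier_vec n"
  shows "A x y = B x y"
proof (rule eq_vecI)
  show "dim_vec (A x y) = dim_vec (B x y)" using algebrasD A B x y by metis
  fix k assume "k < dim_vec (B x y)"
  then have "k < n" using algebrasD(2)[OF B x y] by simp
  then show "A x y $ k = B x y $ k"
    unfolding algebra_expand[OF A x y \<open>k < n\<close>] algebra_expand[OF B x y \<open>k < n\<close>]
    by (intro sum.cong refl) (use eq in \<open>auto simp: idx_def\<close>)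
qed

lemma GL_pairsD:
  assumes "(g, h) \<in> GL_pairs n"
  shows "g \<in> carrier_mat n n" "h \<in> carrier_mat n n" "g * h = 1\<^sub>m n" "h * g = 1\<^sub>m n"
    "x \<in> carrier_vec n \<Longrightarrow> g *\<^sub>v (h *\<^sub>v x) = x" "x \<in> carrier_vec n \<Longrightarrow> h *\<^sub>v (g *\<^sub>v x) = x"
proof -
  show *: "g \<in> carrier_mat n n" "h \<in> carrier_mat n n" "g * h = 1\<^sub>m n" "h * g = 1\<^sub>m n"
    using assms by (auto simp: GL_pairs_def)
  show "x \<in> carrier_vec n \<Longrightarrow> g *\<^sub>v (h *\<^sub>v x) = x" "x \<in> carrier_vec n \<Longrightarrow> h *\<^sub>v (g *\<^sub>v x) = x"
    using * by (metis assoc_mult_mat_vec one_mult_mat_vec)+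
qed

lemma GL_pairs_inverts:
  assumes "(g, h) \<in> GL_pairs n"
  shows "inverts_mat g h" "inverts_mat h g"
  using GL_pairsD(1-4)[OF assms] by (auto simp: inverts_mat_def)

lemma transport_algebras:
  assumes "A \<in> algebras n" "m \<in> GL_pairs n"
  shows "transport A m \<in> algebras n"
proof -
  obtain g h where m: "m = (g, h)" "(g, h) \<in> GL_pairs n" using assms(2) by (cases m) auto
  note G = GL_pairsD[OF m(2)] and D = algebrasD[OF assms(1)]
  show ?thesis
    unfolding algebras_def transport_def m
    using G D by (auto simp: mult_add_distrib_mat_vec mult_mat_vec)
qed

lemma mult_unit_vec_index:
  fixes h :: "complex mat"
  assumes "h \<in> carrier_mat n n" "i < n" "a < n"
  shows "(h *\<^sub>v unit_vec n i) $ a = h $$ (a, i)"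
  using assms by (simp add: scalar_prod_right_unit)

lemma sc_transport:
  assumes A: "A \<in> algebras n" and m: "(g, h) \<in> GL_pairs n" and "i < n" "j < n" "k < n"
  shows "sc n (transport A (g, h)) (i, j, k) =
    (\<Sum>c<n. g $$ (k, c) * (\<Sum>a<n. \<Sum>b<n. h $$ (a, i) * h $$ (b, j) * sc n A (a, b, c)))"
proof -
  note G = GL_pairsD[OF m]
  have v: "h *\<^sub>v unit_vec n i \<in> carrier_vec n" for i using G by auto
  have "sc n (transport A (g, h)) (i, j, k)
      = (\<Sum>c<n. g $$ (k, c) * A (h *\<^sub>v unit_vec n i) (h *\<^sub>v unit_vec n j) $ c)"
    using assms G algebrasD(2)[OF A v v]
    by (simp add: sc_def transport_def scalar_prod_def lessThan_atLeast0)
  also have "\<dots> = (\<Sum>c<n. g $$ (k, c) * (\<Sum>a<n. \<Sum>b<n. h $$ (a, i) * h $$ (b, j) * sc n A (a, b, c)))"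
    by (intro sum.cong refl)
       (use assms G in \<open>auto simp: algebra_expand[OF A v v] mult_unit_vec_index intro!: sum.cong\<close>)
  finally show ?thesis .
qed

lemma transport_in_orb:
  assumes "A \<in> algebras n" "m \<in> GL_pairs n"
  shows "transport A m \<in> orb n A"
proof -
  obtain g h where m: "m = (g, h)" "(g, h) \<in> GL_pairs n" using assms(2) by (cases m) auto
  have "transport A m x y = g *\<^sub>v A (h *\<^sub>v x) (h *\<^sub>v y)" for x y
    by (simp add: m transport_def)
  then show ?thesis
    using GL_pairs_inverts[OF m(2)] GL_pairsD(1,2)[OF m(2)] transport_algebras[OF assms]
    unfolding orb_def by blast
qed

lemma orbE:
  assumes "B \<in> orb n A"
  obtains m where "m \<in> GL_pairs n"
    "\<And>x y. x \<in> carrier_vec n \<Longrightarrow> y \<in> carrier_vec n \<Longrightarrow> B x y = transport A m x y"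
proof -
  obtain g h where "g \<in> carrier_mat n n" "h \<in> carrier_mat n n" "inverts_mat g h" "inverts_mat h g"
    "\<forall>x\<in>carrier_vec n. \<forall>y\<in>carrier_vec n. B x y = g *\<^sub>v A (h *\<^sub>v x) (h *\<^sub>v y)"
    using assms unfolding orb_def by auto
  then show ?thesis
    by (intro that[of "(g, h)"]) (auto simp: GL_pairs_def inverts_mat_def transport_def)
qed

lemma orbI:
  assumes A: "A \<in> algebras n" and B: "B \<in> algebras n" and m: "m \<in> GL_pairs n"
    and eq: "\<And>t. t \<in> idx n \<Longrightarrow> sc n B t = sc n (transport A m) t"
  shows "B \<in> orb n A"
proof -
  obtain g h where m': "m = (g, h)" "(g, h) \<in> GL_pairs n" using m by (cases m) auto
  have "B x y = g *\<^sub>v A (h *\<^sub>v x) (h *\<^sub>v y)" if "x \<in> carrier_vec n" "y \<in> carrier_vec n" for x y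
    using algebra_eqI[OF B transport_algebras[OF A m] eq that] by (simp add: transport_def m')
  then show ?thesis
    using GL_pairs_inverts[OF m'(2)] GL_pairsD(1,2)[OF m'(2)] B unfolding orb_def by blast
qed

section \<open>Symmetry and transitivity of isomorphism\<close>

lemma alg_iso_iff:
  "alg_iso n A B \<longleftrightarrow> (\<exists>(g, h)\<in>GL_pairs n. \<forall>x\<in>carrier_vec n. \<forall>y\<in>carrier_vec n.
     g *\<^sub>v A x y = B (g *\<^sub>v x) (g *\<^sub>v y))"
proof
  assume "alg_iso n A B"
  then obtain g h where g: "g \<in> carrier_mat n n" "inverts_mat g h" "inverts_mat h g"
    "\<forall>x\<in>carrier_vec n. \<forall>y\<in>carrier_vec n. g *\<^sub>v A x y = B (g *\<^sub>v x) (g *\<^sub>v y)"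
    unfolding alg_iso_def invertible_mat_def by blast
  have "dim_col (g * h) = n" "dim_col (h * g) = dim_row h"
    using g unfolding inverts_mat_def by auto
  then have "h \<in> carrier_mat n n" using g(1) by auto
  then have "(g, h) \<in> GL_pairs n" using g unfolding GL_pairs_def inverts_mat_def by auto
  then show "\<exists>(g, h)\<in>GL_pairs n. \<forall>x\<in>carrier_vec n. \<forall>y\<in>carrier_vec n.
     g *\<^sub>v A x y = B (g *\<^sub>v x) (g *\<^sub>v y)" using g by blast
next
  assume "\<exists>(g, h)\<in>GL_pairs n. \<forall>x\<in>carrier_vec n. \<forall>y\<in>carrier_vec n.
     g *\<^sub>v A x y = B (g *\<^sub>v x) (g *\<^sub>v y)"
  then obtain g h where gh: "(g, h) \<in> GL_pairs n"
    and eq: "\<forall>x\<in>carrier_vec n. \<forall>y\<in>carrier_vec n. g *\<^sub>v A x y = B (g *\<^sub>v x) (g *\<^sub>v y)" by blast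
  have "invertible_mat g"
    using GL_pairs_inverts[OF gh] GL_pairsD(1)[OF gh] by (auto simp: invertible_mat_def)
  then show "alg_iso n A B"
    unfolding alg_iso_def using GL_pairsD(1)[OF gh] eq by blast
qed

lemma alg_iso_sym:
  assumes "A \<in> algebras n" "B \<in> algebras n" "alg_iso n A B"
  shows "alg_iso n B A"
proof -
  obtain g h where gh: "(g, h) \<in> GL_pairs n"
    and eq: "\<And>x y. x \<in> carrier_vec n \<Longrightarrow> y \<in> carrier_vec n \<Longrightarrow> g *\<^sub>v A x y = B (g *\<^sub>v x) (g *\<^sub>v y)"
    using assms(3) unfolding alg_iso_iff by blast
  note G = GL_pairsD[OF gh]
  have "h *\<^sub>v B x y = A (h *\<^sub>v x) (h *\<^sub>v y)" if "x \<in> carrier_vec n" "y \<in> carrier_vec n" for x y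
  proof -
    have v: "h *\<^sub>v x \<in> carrier_vec n" "h *\<^sub>v y \<in> carrier_vec n" using G that by auto
    show ?thesis using eq[OF v] G that algebrasD(1)[OF assms(1) v] by metis
  qed
  moreover have "(h, g) \<in> GL_pairs n" using gh by (auto simp: GL_pairs_def)
  ultimately show ?thesis unfolding alg_iso_iff by blast
qed

lemma alg_iso_trans:
  assumes "A \<in> algebras n" "alg_iso n A B" "alg_iso n B C"
  shows "alg_iso n A C"
proof -
  obtain g h where gh: "(g, h) \<in> GL_pairs n"
    and eq: "\<And>x y. x \<in> carrier_vec n \<Longrightarrow> y \<in> carrier_vec n \<Longrightarrow> g *\<^sub>v A x y = B (g *\<^sub>v x) (g *\<^sub>v y)"
    using assms(2) unfolding alg_iso_iff by blast
  obtain g' h' where gh': "(g', h') \<in> GL_pairs n"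
    and eq': "\<And>x y. x \<in> carrier_vec n \<Longrightarrow> y \<in> carrier_vec n \<Longrightarrow> g' *\<^sub>v B x y = C (g' *\<^sub>v x) (g' *\<^sub>v y)"
    using assms(3) unfolding alg_iso_iff by blast
  note G = GL_pairsD[OF gh] and G' = GL_pairsD[OF gh']
  have "g * (h * h') = h'" "h' * (g' * g) = g"
    using assoc_mult_mat[OF G(1,2) G'(2)] assoc_mult_mat[OF G'(2,1) G(1)] G(1-4) G'(1-4) by simp_all
  then have "(g' * g) * (h * h') = 1\<^sub>m n" "(h * h') * (g' * g) = 1\<^sub>m n"
    using assoc_mult_mat[OF G'(1) G(1), of "h * h'" n] assoc_mult_mat[OF G(2) G'(2), of "g' * g" n]
      G(1-4) G'(1-4) by simp_all
  then have "(g' * g, h * h') \<in> GL_pairs n"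
    using G(1,2) G'(1,2) by (auto simp: GL_pairs_def)
  moreover have "(g' * g) *\<^sub>v A x y = C ((g' * g) *\<^sub>v x) ((g' * g) *\<^sub>v y)"
    if "x \<in> carrier_vec n" "y \<in> carrier_vec n" for x y
  proof -
    have v: "g *\<^sub>v x \<in> carrier_vec n" "g *\<^sub>v y \<in> carrier_vec n" using G that by auto
    show ?thesis
      using G(1) G'(1) that v algebrasD(1)[OF assms(1) that] eq[OF that] eq'[OF v]
      by (simp add: assoc_mult_mat_vec)
  qed
  ultimately show ?thesis unfolding alg_iso_iff by blast
qed

section \<open>Orbit closures through a parametrisation\<close>

lemma poly_funs_iff: "q \<in> poly_funs n \<longleftrightarrow> (\<exists>p\<in>poly_in (idx n). q = (\<lambda>A. p (sc n A)))"
proof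
  assume "q \<in> poly_funs n"
  then show "\<exists>p\<in>poly_in (idx n). q = (\<lambda>A. p (sc n A))"
  proof induction
    case (const c)
    then show ?case by (intro bexI[OF _ poly_in.const]) auto
  next
    case (coord i j k)
    then show ?case
      by (intro bexI[OF _ poly_in.coord[of "(i, j, k)"]]) (auto simp: sc_def idx_def)
  next
    case (add p q)
    then obtain p' q' where "p' \<in> poly_in (idx n)" "q' \<in> poly_in (idx n)"
      "p = (\<lambda>A. p' (sc n A))" "q = (\<lambda>A. q' (sc n A))" by blast
    then show ?case by (intro bexI[OF _ poly_in.add[of p' _ q']]) auto
  next
    case (mult p q)
    then obtain p' q' where "p' \<in> poly_in (idx n)" "q' \<in> poly_in (idx n)"
      "p = (\<lambda>A. p' (sc n A))" "q = (\<lambda>A. q' (sc n A))" by blast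
    then show ?case by (intro bexI[OF _ poly_in.mult[of p' _ q']]) auto
  qed
next
  assume "\<exists>p\<in>poly_in (idx n). q = (\<lambda>A. p (sc n A))"
  then obtain p where p: "p \<in> poly_in (idx n)" and q: "q = (\<lambda>A. p (sc n A))" by blast
  from p have "(\<lambda>A. p (sc n A)) \<in> poly_funs n"
    by induction (auto simp: sc_def idx_def intro: poly_funs.intros)
  then show "q \<in> poly_funs n" using q by simp
qed

lemma poly_in_cong:
  assumes "p \<in> poly_in I" "\<And>t. t \<in> I \<Longrightarrow> f t = f' t"
  shows "p f = p f'"
  using assms by induction auto

text \<open>Outside \<^term>\<open>GL_pairs n\<close> the parametrisation of the orbit takes the value at the identity.\<close>

definition GL_norm :: "nat \<Rightarrow> complex mat \<times> complex mat \<Rightarrow> complex mat \<times> complex mat" where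
  "GL_norm n m = (if m \<in> GL_pairs n then m else (1\<^sub>m n, 1\<^sub>m n))"

text \<open>Ring elements are functions on the whole type of matrix pairs. Normalising the argument
  ensures that a polynomial in these coordinates is the zero function exactly when it vanishes on
  the group.\<close>

definition orb_map :: "nat \<Rightarrow> mult \<Rightarrow> complex mat \<times> complex mat \<Rightarrow> nat \<times> nat \<times> nat \<Rightarrow> complex" where
  "orb_map n A m = sc n (transport A (GL_norm n m))"

lemma GL_norm: "GL_norm n m \<in> GL_pairs n" "m \<in> GL_pairs n \<Longrightarrow> GL_norm n m = m"
  by (auto simp: GL_norm_def GL_pairs_def)

lemma vanishes_on_orb_iff:
  assumes A: "A \<in> algebras n" and p: "p \<in> poly_in (idx n)"
  shows "(\<forall>B\<in>orb n A. p (sc n B) = 0) \<longleftrightarrow> p \<circ> orb_map n A = 0"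
proof
  assume "\<forall>B\<in>orb n A. p (sc n B) = 0"
  then show "p \<circ> orb_map n A = 0"
    using transport_in_orb[OF A GL_norm(1)] by (auto simp: fun_eq_iff orb_map_def)
next
  assume z: "p \<circ> orb_map n A = 0"
  show "\<forall>B\<in>orb n A. p (sc n B) = 0"
  proof
    fix B assume "B \<in> orb n A"
    then obtain m where m: "m \<in> GL_pairs n"
      "\<And>x y. x \<in> carrier_vec n \<Longrightarrow> y \<in> carrier_vec n \<Longrightarrow> B x y = transport A m x y"
      by (rule orbE) blast
    then have "p (sc n B) = p (orb_map n A m)"
      by (intro poly_in_cong[OF p]) (auto simp: orb_map_def GL_norm sc_def idx_def)
    also have "\<dots> = 0" using fun_cong[OF z, of m] by simp
    finally show "p (sc n B) = 0" .
  qed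
qed

text \<open>In this form a degeneration is the hypothesis \<open>spec\<close> of the lemmas on
  transcendence degree, with the two orbit maps as parametrisations.\<close>

lemma degenerates_iff:
  "degenerates n A B \<longleftrightarrow> A \<in> algebras n \<and> B \<in> algebras n \<and>
     (\<forall>p\<in>poly_in (idx n). p \<circ> orb_map n A = 0 \<longrightarrow> p \<circ> orb_map n B = 0)"
proof -
  have alg: "orb n B \<subseteq> algebras n" by (auto simp: orb_def)
  have "zariski_closure n (orb n A) =
    {C\<in>algebras n. \<forall>p\<in>poly_in (idx n). (\<forall>D\<in>orb n A. p (sc n D) = 0) \<longrightarrow> p (sc n C) = 0}"
    unfolding zariski_closure_def Ball_def poly_funs_iff by blast
  then have "orb n B \<subseteq> zariski_closure n (orb n A) \<longleftrightarrow>
    (\<forall>p\<in>poly_in (idx n). (\<forall>C\<in>orb n A. p (sc n C) = 0) \<longrightarrow> (\<forall>C\<in>orb n B. p (sc n C) = 0))"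
    using alg by blast
  then show ?thesis unfolding degenerates_def using vanishes_on_orb_iff by blast
qed

section \<open>Orbits are irreducible\<close>

definition mat_line :: "nat \<Rightarrow> complex mat \<Rightarrow> complex mat \<Rightarrow> complex poly mat" where
  "mat_line n a b = mat n n (\<lambda>(i, j). [:a $$ (i, j), b $$ (i, j) - a $$ (i, j):])"

definition mat_at :: "complex poly mat \<Rightarrow> complex \<Rightarrow> complex mat" where
  "mat_at G t = map_mat (\<lambda>p. poly p t) G"

text \<open>Restriction to a line through two invertible matrices reduces the absence of zero divisors to
  univariate polynomials.\<close>

definition line_rational :: "nat \<Rightarrow> (complex mat \<times> complex mat \<Rightarrow> complex) set" where
  "line_rational n = {f. (\<forall>m. f m = f (GL_norm n m)) \<and>
     (\<forall>a\<in>carrier_mat n n. \<forall>b\<in>carrier_mat n n. \<exists>d p. d \<noteq> 0 \<and> (\<forall>t h. (mat_at (mat_line n a b) t, h) \<in> GL_pairs n \<longrightarrow>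
       poly d t \<noteq> 0 \<and> f (mat_at (mat_line n a b) t, h) * poly d t = poly p t))}"

lemma mat_at_hom:
  assumes "G \<in> carrier_mat n n" "H \<in> carrier_mat n n"
  shows "mat_at (G * H) t = mat_at G t * mat_at H t" "det (mat_at G t) = poly (det G) t"
    "mat_at (p \<cdot>\<^sub>m G) t = poly p t \<cdot>\<^sub>m mat_at G t" "mat_at (1\<^sub>m n) t = 1\<^sub>m n"
proof -
  interpret eval: comm_ring_hom "\<lambda>p :: complex poly. poly p t"
    by unfold_locales auto
  show "mat_at (G * H) t = mat_at G t * mat_at H t" "det (mat_at G t) = poly (det G) t"
    unfolding mat_at_def using eval.mat_hom_mult[OF assms] by auto
  show "mat_at (p \<cdot>\<^sub>m G) t = poly p t \<cdot>\<^sub>m mat_at G t" "mat_at (1\<^sub>m n) t = 1\<^sub>m n"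
    using assms by (auto simp: mat_at_def)
qed

lemma mat_line_at:
  assumes "a \<in> carrier_mat n n" "b \<in> carrier_mat n n"
  shows "mat_at (mat_line n a b) 0 = a" "mat_at (mat_line n a b) 1 = b"
    "mat_line n a b \<in> carrier_mat n n" "mat_at (mat_line n a b) t \<in> carrier_mat n n"
  using assms by (auto simp: mat_at_def mat_line_def)

lemma GL_pairs_det:
  assumes "(g, h) \<in> GL_pairs n"
  shows "det g \<noteq> 0"
  using det_mult[of g n h] GL_pairsD(1-4)[OF assms] by auto

lemma GL_pairs_exists:
  assumes "g \<in> carrier_mat n n" "det (g :: complex mat) \<noteq> 0"
  obtains h where "(g, h) \<in> GL_pairs n"
proof
  have "(inverse (det g) \<cdot>\<^sub>m adj_mat g) * g = 1\<^sub>m n" "g * (inverse (det g) \<cdot>\<^sub>m adj_mat g) = 1\<^sub>m n"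
    using adj_mat[OF assms(1)] assms
    by (auto simp: mult_smult_assoc_mat[of _ n n _ n] mult_smult_distrib[of _ n n _ n])
  then show "(g, inverse (det g) \<cdot>\<^sub>m adj_mat g) \<in> GL_pairs n"
    using adj_mat[OF assms(1)] assms by (auto simp: GL_pairs_def)
qed

lemma line_rationalE:
  assumes "f \<in> line_rational n" "a \<in> carrier_mat n n" "b \<in> carrier_mat n n"
  obtains d p where "d \<noteq> 0" "\<And>t h. (mat_at (mat_line n a b) t, h) \<in> GL_pairs n \<Longrightarrow>
       poly d t \<noteq> 0 \<and> f (mat_at (mat_line n a b) t, h) * poly d t = poly p t"
  using assms unfolding line_rational_def by blast

lemma line_rationalI:
  assumes "\<And>m. f m = f (GL_norm n m)"
    and "\<And>a b. a \<in> carrier_mat n n \<Longrightarrow> b \<in> carrier_mat n n \<Longrightarrow> \<exists>d p. d \<noteq> 0 \<and>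
      (\<forall>t h. (mat_at (mat_line n a b) t, h) \<in> GL_pairs n \<longrightarrow>
        poly d t \<noteq> 0 \<and> f (mat_at (mat_line n a b) t, h) * poly d t = poly p t)"
  shows "f \<in> line_rational n"
  using assms unfolding line_rational_def by blast

lemma line_rational_norm: "f \<in> line_rational n \<Longrightarrow> f (GL_norm n m) = f m"
  unfolding line_rational_def mem_Collect_eq by metis

lemma line_rational_const: "(\<lambda>_. c) \<in> line_rational n"
  by (rule line_rationalI, simp, rule exI[of _ 1], rule exI[of _ "[:c:]"]) simp

lemma line_rational_subring: "is_subring (line_rational n)"
  unfolding is_subring_def
proof (intro conjI ballI)
  show "1 \<in> line_rational n" using line_rational_const[of 1] by (simp add: one_fun_def)
  fix f f' assume f: "f \<in> line_rational n" and f': "f' \<in> line_rational n"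
  note norm = line_rational_norm[OF f] line_rational_norm[OF f']
  have "\<exists>d p q. d \<noteq> 0 \<and> (\<forall>t h. (mat_at (mat_line n a b) t, h) \<in> GL_pairs n \<longrightarrow>
      poly d t \<noteq> 0 \<and> (f - f') (mat_at (mat_line n a b) t, h) * poly d t = poly p t
       \<and> (f * f') (mat_at (mat_line n a b) t, h) * poly d t = poly q t)"
    if ab: "a \<in> carrier_mat n n" "b \<in> carrier_mat n n" for a b :: "complex mat"
  proof -
    obtain d p where 1: "d \<noteq> 0" "\<And>t h. (mat_at (mat_line n a b) t, h) \<in> GL_pairs n \<Longrightarrow>
       poly d t \<noteq> 0 \<and> f (mat_at (mat_line n a b) t, h) * poly d t = poly p t"
      by (rule line_rationalE[OF f ab]) blast
    obtain d' p' where 2: "d' \<noteq> 0" "\<And>t h. (mat_at (mat_line n a b) t, h) \<in> GL_pairs n \<Longrightarrow>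
       poly d' t \<noteq> 0 \<and> f' (mat_at (mat_line n a b) t, h) * poly d' t = poly p' t"
      by (rule line_rationalE[OF f' ab]) blast
    show ?thesis
    proof (rule exI[of _ "d * d'"], rule exI[of _ "p * d' - p' * d"], rule exI[of _ "p * p'"],
        intro conjI allI impI)
      fix t h assume "(mat_at (mat_line n a b) t, h) \<in> GL_pairs n"
      note 3 = 1(2)[OF this] 2(2)[OF this]
      then show "poly (d * d') t \<noteq> 0" by simp
      have 4: "poly p t = f (mat_at (mat_line n a b) t, h) * poly d t"
        "poly p' t = f' (mat_at (mat_line n a b) t, h) * poly d' t" using 3 by auto
      show "(f - f') (mat_at (mat_line n a b) t, h) * poly (d * d') t = poly (p * d' - p' * d) t"
        by (simp add: 4 algebra_simps)
      show "(f * f') (mat_at (mat_line n a b) t, h) * poly (d * d') t = poly (p * p') t"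
        by (simp add: 4 algebra_simps)
    qed (use 1 2 in auto)
  qed
  note ex = this
  show "f - f' \<in> line_rational n"
  proof (rule line_rationalI)
    fix m show "(f - f') m = (f - f') (GL_norm n m)" by (simp add: norm)
  next
    fix a b :: "complex mat"
    assume "a \<in> carrier_mat n n" "b \<in> carrier_mat n n"
    from ex[OF this] obtain d p q where dpq: "d \<noteq> 0"
      "\<forall>t h. (mat_at (mat_line n a b) t, h) \<in> GL_pairs n \<longrightarrow>
        poly d t \<noteq> 0 \<and> (f - f') (mat_at (mat_line n a b) t, h) * poly d t = poly p t
         \<and> (f * f') (mat_at (mat_line n a b) t, h) * poly d t = poly q t" by (elim exE conjE)
    show "\<exists>d p. d \<noteq> 0 \<and> (\<forall>t h. (mat_at (mat_line n a b) t, h) \<in> GL_pairs n \<longrightarrow>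
        poly d t \<noteq> 0 \<and> (f - f') (mat_at (mat_line n a b) t, h) * poly d t = poly p t)"
      by (rule exI[of _ d], rule exI[of _ p]) (use dpq in simp)
  qed
  show "f * f' \<in> line_rational n"
  proof (rule line_rationalI)
    fix m show "(f * f') m = (f * f') (GL_norm n m)" by (simp add: norm)
  next
    fix a b :: "complex mat"
    assume "a \<in> carrier_mat n n" "b \<in> carrier_mat n n"
    from ex[OF this] obtain d p q where dpq: "d \<noteq> 0"
      "\<forall>t h. (mat_at (mat_line n a b) t, h) \<in> GL_pairs n \<longrightarrow>
        poly d t \<noteq> 0 \<and> (f - f') (mat_at (mat_line n a b) t, h) * poly d t = poly p t
         \<and> (f * f') (mat_at (mat_line n a b) t, h) * poly d t = poly q t" by (elim exE conjE)
    show "\<exists>d p. d \<noteq> 0 \<and> (\<forall>t h. (mat_at (mat_line n a b) t, h) \<in> GL_pairs n \<longrightarrow>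
        poly d t \<noteq> 0 \<and> (f * f') (mat_at (mat_line n a b) t, h) * poly d t = poly p t)"
      by (rule exI[of _ d], rule exI[of _ q]) (use dpq in simp)
  qed
qed

lemma line_rational_zero_divisor_free: "zero_divisor_free (line_rational n)"
  unfolding zero_divisor_free_def
proof (intro ballI impI)
  fix f f' assume f: "f \<in> line_rational n" and f': "f' \<in> line_rational n" and z: "f * f' = 0"
  show "f = 0 \<or> f' = 0"
  proof (rule ccontr)
    assume "\<not> (f = 0 \<or> f' = 0)"
    then obtain m1 m2 where "f m1 \<noteq> 0" "f' m2 \<noteq> 0" by (auto simp: fun_eq_iff)
    then have "f (GL_norm n m1) \<noteq> 0" "f' (GL_norm n m2) \<noteq> 0"
      by (simp_all add: line_rational_norm[OF f] line_rational_norm[OF f'])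
    then obtain a a' b b' where nz: "f (a, a') \<noteq> 0" "f' (b, b') \<noteq> 0"
      and ga: "(a, a') \<in> GL_pairs n" and gb: "(b, b') \<in> GL_pairs n"
      using GL_norm(1)[of n m1] GL_norm(1)[of n m2] by (metis surj_pair)
    note ab = GL_pairsD(1)[OF ga] GL_pairsD(1)[OF gb]
    let ?L = "mat_line n a b"
    note L = mat_line_at[OF ab]
    obtain d p where 1: "\<And>t h. (mat_at ?L t, h) \<in> GL_pairs n \<Longrightarrow>
       poly d t \<noteq> 0 \<and> f (mat_at ?L t, h) * poly d t = poly p t"
      by (rule line_rationalE[OF f ab]) blast
    obtain d' p' where 2: "\<And>t h. (mat_at ?L t, h) \<in> GL_pairs n \<Longrightarrow>
       poly d' t \<noteq> 0 \<and> f' (mat_at ?L t, h) * poly d' t = poly p' t"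
      by (rule line_rationalE[OF f' ab]) blast
    have "poly p 0 \<noteq> 0" "poly p' 1 \<noteq> 0" "poly (det ?L) 0 \<noteq> 0"
      using 1[of 0 a'] 2[of 1 b'] L ga gb nz GL_pairs_det[OF ga] mat_at_hom(2)[of ?L n ?L 0] by auto
    \<comment> \<open>The numerators of \<open>f\<close> and \<open>f'\<close> along the line are
      non-zero at one end each, so a common non-root exists; the factor \<open>det ?L\<close> keeps
      the chosen point inside the group.\<close>
    then have "p * p' * det ?L \<noteq> 0" by auto
    then obtain t where t: "poly (p * p' * det ?L) t \<noteq> 0" by (rule finite_roots_avoid)
    then have "det (mat_at ?L t) \<noteq> 0" using mat_at_hom(2)[of ?L n ?L t] L by auto
    then obtain h where h: "(mat_at ?L t, h) \<in> GL_pairs n" using GL_pairs_exists L by blast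
    have "f (mat_at ?L t, h) \<noteq> 0" "f' (mat_at ?L t, h) \<noteq> 0" using 1[OF h] 2[OF h] t by auto
    then show False using fun_cong[OF z, of "(mat_at ?L t, h)"] by simp
  qed
qed

section \<open>Coordinates of the general linear group\<close>

definition entry :: "nat \<Rightarrow> nat \<Rightarrow> nat \<Rightarrow> complex mat \<times> complex mat \<Rightarrow> complex" where
  "entry n i j m = fst (GL_norm n m) $$ (i, j)"

definition inv_entry :: "nat \<Rightarrow> nat \<Rightarrow> nat \<Rightarrow> complex mat \<times> complex mat \<Rightarrow> complex" where
  "inv_entry n i j m = snd (GL_norm n m) $$ (i, j)"

lemma entry_line_rational:
  assumes "i < n" "j < n"
  shows "entry n i j \<in> line_rational n" "inv_entry n i j \<in> line_rational n"
proof -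
  show "entry n i j \<in> line_rational n"
  proof (rule line_rationalI)
    fix a b :: "complex mat"
    assume ab: "a \<in> carrier_mat n n" "b \<in> carrier_mat n n"
    show "\<exists>d p. d \<noteq> 0 \<and> (\<forall>t h. (mat_at (mat_line n a b) t, h) \<in> GL_pairs n \<longrightarrow>
        poly d t \<noteq> 0 \<and> entry n i j (mat_at (mat_line n a b) t, h) * poly d t = poly p t)"
      by (rule exI[of _ 1], rule exI[of _ "mat_line n a b $$ (i, j)"])
         (use assms in \<open>auto simp: entry_def GL_norm(2) mat_at_def mat_line_def\<close>)
  qed (simp add: entry_def GL_norm)
  show "inv_entry n i j \<in> line_rational n"
  proof (rule line_rationalI)
    fix a b :: "complex mat"
    assume ab: "a \<in> carrier_mat n n" "b \<in> carrier_mat n n"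
    let ?L = "mat_line n a b"
    note L = mat_line_at[OF ab]
    note adj = adj_mat[OF L(3)]
    show "\<exists>d p. d \<noteq> 0 \<and> (\<forall>t h. (mat_at ?L t, h) \<in> GL_pairs n \<longrightarrow>
        poly d t \<noteq> 0 \<and> inv_entry n i j (mat_at ?L t, h) * poly d t = poly p t)"
    proof (cases "det ?L = 0")
      case True
      \<comment> \<open>A line without invertible points imposes no condition, so the denominator 1
        will do. In the other case Cramer's rule supplies numerator and denominator.\<close>
      then have "(mat_at ?L t, h) \<notin> GL_pairs n" for t h
        using GL_pairs_det mat_at_hom(2)[OF L(3) L(3), of t] by auto
      then show ?thesis by (intro exI[of _ 1]) auto
    next
      case False
      show ?thesis
      proof (rule exI[of _ "det ?L"], rule exI[of _ "adj_mat ?L $$ (i, j)"], intro conjI allI impI False)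
        fix t h assume gh: "(mat_at ?L t, h) \<in> GL_pairs n"
        note G = GL_pairsD(1-4)[OF gh]
        show "poly (det ?L) t \<noteq> 0"
          using GL_pairs_det[OF gh] mat_at_hom(2)[OF L(3) L(3), of t] by auto
        have A: "mat_at (adj_mat ?L) t \<in> carrier_mat n n" using adj by (auto simp: mat_at_def)
        have "mat_at ?L t * mat_at (adj_mat ?L) t = poly (det ?L) t \<cdot>\<^sub>m 1\<^sub>m n"
          using mat_at_hom(1)[OF L(3) adj(1), of t] adj(2) mat_at_hom(3,4)[of "1\<^sub>m n" n "1\<^sub>m n"] by simp
        then have "h * (mat_at ?L t * mat_at (adj_mat ?L) t) = poly (det ?L) t \<cdot>\<^sub>m h"
          using G by (simp add: mult_smult_distrib[of _ n n _ n])
        then have "mat_at (adj_mat ?L) t = poly (det ?L) t \<cdot>\<^sub>m h"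
          using assoc_mult_mat[OF G(2,1) A] G A by simp
        then have "mat_at (adj_mat ?L) t $$ (i, j) = (poly (det ?L) t \<cdot>\<^sub>m h) $$ (i, j)" by simp
        then show "inv_entry n i j (mat_at ?L t, h) * poly (det ?L) t = poly (adj_mat ?L $$ (i, j)) t"
          using assms adj(1) G gh by (simp add: inv_entry_def GL_norm(2) mat_at_def)
      qed
    qed
  qed (simp add: inv_entry_def GL_norm)
qed

lemma sum_fun: "(\<Sum>i\<in>I. f i) = (\<lambda>m. \<Sum>i\<in>I. f i m :: complex)"
  by (induction I rule: infinite_finite_induct) (auto simp: fun_eq_iff)

text \<open>Stated as an identity of functions, so that a subring containing the matrix entries
  contains the orbit coordinates, and a ring homomorphism can be applied to both sides.\<close>

lemma orb_map_coord:
  assumes "A \<in> algebras n" "i < n" "j < n" "k < n"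
  shows "(\<lambda>m. orb_map n A m (i, j, k)) = (\<Sum>c<n. entry n k c *
    (\<Sum>a<n. \<Sum>b<n. inv_entry n a i * inv_entry n b j * (\<lambda>_. sc n A (a, b, c))))"
proof
  fix m
  obtain g h where gh: "GL_norm n m = (g, h)" by (cases "GL_norm n m")
  then have "(g, h) \<in> GL_pairs n" using GL_norm(1)[of n m] by simp
  from sc_transport[OF assms(1) this assms(2-4)]
  show "orb_map n A m (i, j, k) = (\<Sum>c<n. entry n k c *
    (\<Sum>a<n. \<Sum>b<n. inv_entry n a i * inv_entry n b j * (\<lambda>_. sc n A (a, b, c)))) m"
    by (simp add: orb_map_def gh sum_fun entry_def inv_entry_def)
qed

lemma pullback_orb_map_subset:
  assumes A: "A \<in> algebras n" and U: "is_subring U" "\<And>c. (\<lambda>_. c) \<in> U"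
    "\<And>i j. i < n \<Longrightarrow> j < n \<Longrightarrow> entry n i j \<in> U \<and> inv_entry n i j \<in> U"
  shows "pullback (orb_map n A) (idx n) \<subseteq> U"
proof (rule pullback_least)
  fix t assume "t \<in> idx n"
  then obtain i j k where t: "t = (i, j, k)" "i < n" "j < n" "k < n" by (auto simp: idx_def)
  show "(\<lambda>m. orb_map n A m t) \<in> U"
    unfolding t(1) orb_map_coord[OF A t(2-4)]
    using t U by (intro is_subring_sum[OF U(1)] is_subringD(4)[OF U(1)]) auto
qed (use U in auto)

lemma orb_zero_divisor_free:
  "A \<in> algebras n \<Longrightarrow> zero_divisor_free (pullback (orb_map n A) (idx n))"
  by (rule zero_divisor_free_subset[OF line_rational_zero_divisor_free pullback_orb_map_subset])
     (auto intro: line_rational_subring line_rational_const entry_line_rational)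

section \<open>An orbit contains a dense open subset of its closure\<close>

text \<open>A point \<open>B\<close> of the closure is a homomorphism on the coordinate ring of the orbit. It extends
  to the coordinate ring of the general linear group unless it kills one fixed function \<open>q\<close>,
  and such an extension is a matrix that carries \<open>A\<close> to \<open>B\<close>.\<close>

lemma orb_contains_open:
  assumes A: "A \<in> algebras n"
  obtains q where "q \<in> poly_in (idx n)" "q \<circ> orb_map n A \<noteq> 0"
    "\<And>B. B \<in> algebras n \<Longrightarrow> (\<And>p. p \<in> poly_in (idx n) \<Longrightarrow> p \<circ> orb_map n A = 0 \<Longrightarrow> p (sc n B) = 0) \<Longrightarrow>
      q (sc n B) \<noteq> 0 \<Longrightarrow> B \<in> orb n A"
proof -
  let ?R = "pullback (orb_map n A) (idx n)"
  have R: "is_subring ?R" by (rule pullback_subring)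
  define xs where "xs = map (\<lambda>(i, j). entry n i j) (List.product [0..<n] [0..<n])
    @ map (\<lambda>(i, j). inv_entry n i j) (List.product [0..<n] [0..<n])"
  let ?S = "adjoin_list ?R xs"
  have props: "is_subring ?S" "?R \<subseteq> ?S" "set xs \<subseteq> ?S" using adjoin_list_props[OF R, of xs] by auto
  have xs: "entry n i j \<in> ?S" "inv_entry n i j \<in> ?S" if "i < n" "j < n" for i j
  proof -
    have "entry n i j \<in> set xs" "inv_entry n i j \<in> set xs"
      using that unfolding xs_def by (force simp: image_iff)+
    then show "entry n i j \<in> ?S" "inv_entry n i j \<in> ?S" using props by auto
  qed
  have c: "(\<lambda>_. c) \<in> ?R" for c by (rule const_in_pullback)
  have "?S \<subseteq> line_rational n"
    by (intro adjoin_list_least line_rational_subring pullback_orb_map_subset[OF A])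
       (auto simp: xs_def entry_line_rational line_rational_const)
  then have dom: "zero_divisor_free ?S"
    by (rule zero_divisor_free_subset[OF line_rational_zero_divisor_free])
  \<comment> \<open>Only the extension is wanted here, so the element to be kept non-zero is
    \<open>1\<close>.\<close>
  have "(1 :: complex mat \<times> complex mat \<Rightarrow> complex) \<noteq> 0" by (simp add: fun_eq_iff)
  from ring_hom_list_extension[OF R dom is_subringD(1)[OF props(1)] this]
  obtain v where v: "v \<in> ?R" "v \<noteq> 0" and ext: "\<And>\<phi>. ring_hom_on ?R \<phi> \<Longrightarrow> \<phi> v \<noteq> 0 \<Longrightarrow>
    \<exists>\<psi>. ring_hom_on ?S \<psi> \<and> (\<forall>a\<in>?R. \<psi> a = \<phi> a)" by blast
  obtain q where q: "q \<in> poly_in (idx n)" "v = q \<circ> orb_map n A" using v by (auto simp: pullback_def)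
  show ?thesis
  proof (rule that[OF q(1)])
    show "q \<circ> orb_map n A \<noteq> 0" using v q by simp
    fix B assume B: "B \<in> algebras n"
      and cl: "\<And>p. p \<in> poly_in (idx n) \<Longrightarrow> p \<circ> orb_map n A = 0 \<Longrightarrow> p (sc n B) = 0"
      and qB: "q (sc n B) \<noteq> 0"
    \<comment> \<open>Evaluation at \<open>B\<close> through a chosen representative. By
      \<open>cl\<close>, polynomials vanishing on the orbit of \<open>A\<close> vanish at
      \<open>B\<close>, so the choice does not matter.\<close>
    define \<phi> where "\<phi> r = (SOME p. p \<in> poly_in (idx n) \<and> p \<circ> orb_map n A = r) (sc n B)" for r
    have phi: "\<phi> (p \<circ> orb_map n A) = p (sc n B)" if p: "p \<in> poly_in (idx n)" for p
    proof -
      define p' where "p' = (SOME p'. p' \<in> poly_in (idx n) \<and> p' \<circ> orb_map n A = p \<circ> orb_map n A)"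
      have "p' \<in> poly_in (idx n) \<and> p' \<circ> orb_map n A = p \<circ> orb_map n A"
        unfolding p'_def by (rule someI[of _ p]) (use p in auto)
      then have p': "p' \<in> poly_in (idx n)" "p' \<circ> orb_map n A = p \<circ> orb_map n A" by auto
      have "(\<lambda>f. p' f + (\<lambda>_. - 1) f * p f) \<in> poly_in (idx n)"
        by (rule poly_in.add[OF p'(1) poly_in.mult[OF poly_in.const p]])
      then have "(\<lambda>f. p' f + (\<lambda>_. - 1) f * p f) (sc n B) = 0"
        by (rule cl) (use p'(2) in \<open>simp add: fun_eq_iff\<close>)
      then show ?thesis unfolding \<phi>_def p'_def[symmetric] by simp
    qed
    have "ring_hom_on ?R \<phi>"
      unfolding ring_hom_on_def pullback_def
    proof (intro conjI ballI; (elim imageE)?)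
      show "\<phi> 1 = 1" using phi[OF poly_in.const[of 1]] by (simp add: o_def one_fun_def)
      fix a b p p' assume *: "a = p \<circ> orb_map n A" "b = p' \<circ> orb_map n A"
        "p \<in> poly_in (idx n)" "p' \<in> poly_in (idx n)"
      show "\<phi> (a + b) = \<phi> a + \<phi> b"
        using phi[OF poly_in.add[OF *(3,4)]] phi * by (simp add: o_def plus_fun_def)
      show "\<phi> (a * b) = \<phi> a * \<phi> b"
        using phi[OF poly_in.mult[OF *(3,4)]] phi * by (simp add: o_def times_fun_def)
    qed
    moreover have "\<phi> v \<noteq> 0" using phi q qB by simp
    ultimately obtain \<psi> where \<psi>: "ring_hom_on ?S \<psi>" "\<forall>a\<in>?R. \<psi> a = \<phi> a" using ext by blast
    note H = ring_hom_onD[OF \<psi>(1) props(1)] and sumH = ring_hom_on_sum[OF \<psi>(1) props(1)]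
      and S = is_subringD[OF props(1)] and sumS = is_subring_sum[OF props(1)]
    have const: "\<psi> (\<lambda>_. c) = c" for c
    proof -
      have "\<psi> (\<lambda>_. c) = \<phi> (\<lambda>_. c)" using \<psi>(2) c by blast
      then show ?thesis using phi[OF poly_in.const[of c]] by (simp add: o_def)
    qed
    have cS: "(\<lambda>_. c) \<in> ?S" for c using c props by blast
    have sum_prod: "(\<Sum>k<n. \<psi> (f k) * \<psi> (f' k)) = \<psi> (\<Sum>k<n. f k * f' k)"
      if "\<And>k. k < n \<Longrightarrow> f k \<in> ?S \<and> f' k \<in> ?S" for f f' :: "nat \<Rightarrow> complex mat \<times> complex mat \<Rightarrow> complex"
    proof -
      have "\<psi> (\<Sum>k<n. f k * f' k) = (\<Sum>k<n. \<psi> (f k * f' k))"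
        by (rule sumH) (use that S(4) in auto)
      also have "\<dots> = (\<Sum>k<n. \<psi> (f k) * \<psi> (f' k))"
        by (intro sum.cong refl H(4)) (use that in auto)
      finally show ?thesis by simp
    qed
    define G where "G = mat n n (\<lambda>(i, j). \<psi> (entry n i j))"
    define K where "K = mat n n (\<lambda>(i, j). \<psi> (inv_entry n i j))"
    \<comment> \<open>That the two matrices are inverse to each other is a family of identities in
      \<open>?S\<close>, so \<open>\<psi>\<close> carries it over to \<open>G\<close> and
      \<open>K\<close>.\<close>
    have prod: "(\<Sum>k<n. entry n i k * inv_entry n k j) = (\<lambda>_. if i = j then 1 else 0)"
      "(\<Sum>k<n. inv_entry n i k * entry n k j) = (\<lambda>_. if i = j then 1 else 0)"
      if ij: "i < n" "j < n" for i j
    proof -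
      have "(\<Sum>k<n. entry n i k m * inv_entry n k j m) = (if i = j then 1 else 0)
          \<and> (\<Sum>k<n. inv_entry n i k m * entry n k j m) = (if i = j then 1 else 0)" for m
      proof -
        obtain g h where gh: "GL_norm n m = (g, h)" by (cases "GL_norm n m")
        then have "(g, h) \<in> GL_pairs n" using GL_norm(1)[of n m] by simp
        note G = GL_pairsD(1-4)[OF this]
        have "(g * h) $$ (i, j) = (if i = j then 1 else 0)" "(h * g) $$ (i, j) = (if i = j then 1 else 0)"
          using G(3,4) ij by simp_all
        then show ?thesis using G(1,2) ij
          by (simp add: gh entry_def inv_entry_def scalar_prod_def lessThan_atLeast0)
      qed
      then show "(\<Sum>k<n. entry n i k * inv_entry n k j) = (\<lambda>_. if i = j then 1 else 0)"
        "(\<Sum>k<n. inv_entry n i k * entry n k j) = (\<lambda>_. if i = j then 1 else 0)"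
        by (simp_all add: sum_fun fun_eq_iff)
    qed
    have "G * K = 1\<^sub>m n" "K * G = 1\<^sub>m n"
    proof -
      have "(\<Sum>k<n. \<psi> (entry n i k) * \<psi> (inv_entry n k j)) = (if i = j then 1 else 0)
          \<and> (\<Sum>k<n. \<psi> (inv_entry n i k) * \<psi> (entry n k j)) = (if i = j then 1 else 0)"
        if ij: "i < n" "j < n" for i j
      proof -
        have "(\<Sum>k<n. \<psi> (entry n i k) * \<psi> (inv_entry n k j)) = \<psi> (\<Sum>k<n. entry n i k * inv_entry n k j)"
          "(\<Sum>k<n. \<psi> (inv_entry n i k) * \<psi> (entry n k j)) = \<psi> (\<Sum>k<n. inv_entry n i k * entry n k j)"
          by (rule sum_prod; use ij xs in blast)+
        then show ?thesis unfolding prod[OF ij] const by simp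
      qed
      then show "G * K = 1\<^sub>m n" "K * G = 1\<^sub>m n"
        by (auto simp: G_def K_def scalar_prod_def lessThan_atLeast0 intro!: eq_matI)
    qed
    then have GK: "(G, K) \<in> GL_pairs n" by (auto simp: GL_pairs_def G_def K_def)
    show "B \<in> orb n A"
    proof (rule orbI[OF A B GK])
      fix t assume tI: "t \<in> idx n"
      then obtain i j k where t: "t = (i, j, k)" "i < n" "j < n" "k < n" by (auto simp: idx_def)
      \<comment> \<open>The formula for the action is an identity in \<open>?S\<close> as well; its
        image under \<open>\<psi>\<close> says that \<open>(G, K)\<close> takes \<open>A\<close> to
        \<open>B\<close>.\<close>
      have "sc n B t = \<psi> (\<lambda>m. orb_map n A m t)"
        using phi[OF poly_in.coord[OF tI]] \<psi>(2) coord_in_pullback[OF tI, of "orb_map n A"] by (simp add: o_def)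
      also have "\<dots> = (\<Sum>c<n. \<psi> (entry n k c) * (\<Sum>a<n. \<Sum>b<n. \<psi> (inv_entry n a i) * \<psi> (inv_entry n b j) * sc n A (a, b, c)))"
      proof -
        have 1: "inv_entry n a i * inv_entry n b j * (\<lambda>_. sc n A (a, b, c)) \<in> ?S"
          "\<psi> (inv_entry n a i * inv_entry n b j * (\<lambda>_. sc n A (a, b, c))) =
            \<psi> (inv_entry n a i) * \<psi> (inv_entry n b j) * sc n A (a, b, c)"
          if "a < n" "b < n" for a b c
          using xs(2)[OF that(1) t(2)] xs(2)[OF that(2) t(3)] cS S(4) H(4) const by metis+
        let ?F = "\<lambda>c. \<Sum>a<n. \<Sum>b<n. inv_entry n a i * inv_entry n b j * (\<lambda>_. sc n A (a, b, c))"
        have 2: "?F c \<in> ?S" for c using 1(1) by (intro sumS) auto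
        have 3: "\<psi> (?F c) = (\<Sum>a<n. \<Sum>b<n. \<psi> (inv_entry n a i) * \<psi> (inv_entry n b j) * sc n A (a, b, c))" for c
        proof -
          have "\<psi> (?F c) = (\<Sum>a<n. \<psi> (\<Sum>b<n. inv_entry n a i * inv_entry n b j * (\<lambda>_. sc n A (a, b, c))))"
            by (rule sumH, rule sumS, rule 1) auto
          also have "\<dots> = (\<Sum>a<n. \<Sum>b<n. \<psi> (inv_entry n a i * inv_entry n b j * (\<lambda>_. sc n A (a, b, c))))"
            by (rule sum.cong[OF refl], rule sumH, rule 1) auto
          finally show ?thesis using 1(2) by simp
        qed
        have "\<psi> (\<Sum>c<n. entry n k c * ?F c) = (\<Sum>c<n. \<psi> (entry n k c) * \<psi> (?F c))"
          using sum_prod[of "entry n k" ?F] xs(1)[OF t(4)] 2 by simp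
        then show ?thesis unfolding t(1) orb_map_coord[OF A t(2-4)] 3 .
      qed
      also have "\<dots> = sc n (transport A (G, K)) t"
        unfolding t(1) sc_transport[OF A GK t(2-4)] using t by (simp add: G_def K_def)
      finally show "sc n B t = sc n (transport A (G, K)) t" .
    qed
  qed
qed

text \<open>When the closures coincide, the function \<open>q\<close> that cuts out the open part of
  the closure of the orbit of \<open>A\<close> cannot vanish on the whole orbit of \<open>B\<close>.
  A point of that orbit with \<open>q\<close> non-zero lies in both orbits.\<close>

lemma degenerates_antisym:
  assumes AB: "degenerates n A B" and BA: "degenerates n B A"
  shows "alg_iso n A B"
proof -
  have alg: "A \<in> algebras n" "B \<in> algebras n" using AB by (auto simp: degenerates_iff)
  obtain q where q: "q \<in> poly_in (idx n)" "q \<circ> orb_map n A \<noteq> 0" and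
    open_orb: "\<And>B. B \<in> algebras n \<Longrightarrow> (\<And>p. p \<in> poly_in (idx n) \<Longrightarrow> p \<circ> orb_map n A = 0 \<Longrightarrow> p (sc n B) = 0) \<Longrightarrow>
      q (sc n B) \<noteq> 0 \<Longrightarrow> B \<in> orb n A"
    using orb_contains_open[OF alg(1)] by metis
  have "q \<circ> orb_map n B \<noteq> 0" using BA q by (auto simp: degenerates_iff)
  then obtain m where m: "q (orb_map n B m) \<noteq> 0" by (auto simp: fun_eq_iff)
  define C where "C = transport B (GL_norm n m)"
  have C: "C \<in> algebras n" "C \<in> orb n B" "sc n C = orb_map n B m"
    using transport_algebras[OF alg(2) GL_norm(1)] transport_in_orb[OF alg(2) GL_norm(1)]
    by (auto simp: C_def orb_map_def)
  have "C \<in> orb n A"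
  proof (rule open_orb[OF C(1)])
    fix p assume "p \<in> poly_in (idx n)" "p \<circ> orb_map n A = 0"
    then have "p \<circ> orb_map n B = 0" using AB by (auto simp: degenerates_iff)
    then show "p (sc n C) = 0" using C(3) by (metis comp_apply zero_fun_apply)
  qed (use C m in simp)
  then have "alg_iso n A C" "alg_iso n B C" using orb_iff_alg_iso alg C by auto
  then show ?thesis using alg_iso_trans alg_iso_sym alg C(1) by blast
qed

section \<open>Orbit dimension\<close>

definition orb_dim :: "nat \<Rightarrow> mult \<Rightarrow> nat" where
  "orb_dim n A = trdeg (orb_map n A) (idx n)"

lemma orb_dim_le: "orb_dim n A \<le> card (idx n)"
  unfolding orb_dim_def by (rule trdeg_le_card[OF finite_idx])

lemma orb_dim_less:
  assumes "nontrivial_degen n A B"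
  shows "orb_dim n B < orb_dim n A"
proof (rule ccontr)
  assume *: "\<not> orb_dim n B < orb_dim n A"
  have AB: "degenerates n A B" "\<not> alg_iso n A B" using assms by (auto simp: nontrivial_degen_def)
  then have spec: "p \<circ> orb_map n A = 0 \<Longrightarrow> p \<circ> orb_map n B = 0" if "p \<in> poly_in (idx n)" for p
    using that by (auto simp: degenerates_iff)
  have alg: "A \<in> algebras n" "B \<in> algebras n" using AB by (auto simp: degenerates_iff)
  have "trdeg (orb_map n B) (idx n) \<le> trdeg (orb_map n A) (idx n)"
    by (rule trdeg_mono[OF finite_idx spec])
  then have "trdeg (orb_map n B) (idx n) = trdeg (orb_map n A) (idx n)" using * by (simp add: orb_dim_def)
  then have "degenerates n B A"
    using trdeg_strict[OF finite_idx orb_zero_divisor_free[OF alg(1)] spec] alg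
    by (auto simp: degenerates_iff)
  then show False using degenerates_antisym AB by blast
qed

section \<open>One-parameter degenerations\<close>

lemma poly_in_tendsto:
  assumes "p \<in> poly_in I" "\<And>t. t \<in> I \<Longrightarrow> (\<lambda>N. f N t) \<longlonglongrightarrow> f' t"
  shows "(\<lambda>N :: nat. p (f N)) \<longlonglongrightarrow> p f'"
  using assms by induction (auto intro: tendsto_intros)

lemma orb_trans:
  assumes "A \<in> algebras n" "B \<in> orb n A" "C \<in> orb n B"
  shows "C \<in> orb n A"
proof -
  have "B \<in> algebras n" "C \<in> algebras n" using assms by (auto simp: orb_def)
  then show ?thesis using assms orb_iff_alg_iso alg_iso_trans by blast
qed

text \<open>The closure must contain the whole orbit of \<open>B\<close>, not only \<open>B\<close>.
  Transport by a fixed pair is linear in the structure constants, so it turns the given sequence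
  into one converging to any prescribed point of that orbit.\<close>

lemma degenerates_limit:
  assumes A: "A \<in> algebras n" and B: "B \<in> algebras n" and m: "\<And>N :: nat. m N \<in> GL_pairs n"
    and lim: "\<And>t. t \<in> idx n \<Longrightarrow> (\<lambda>N. sc n (transport A (m N)) t) \<longlonglongrightarrow> sc n B t"
  shows "degenerates n A B"
proof -
  have "p (orb_map n B s) = 0" if p: "p \<in> poly_in (idx n)" and z: "p \<circ> orb_map n A = 0" for p s
  proof -
    obtain g h where gh: "GL_norm n s = (g, h)" by (cases "GL_norm n s")
    then have gh': "(g, h) \<in> GL_pairs n" using GL_norm(1)[of n s] by simp
    have TA: "transport A (m N) \<in> algebras n" for N using transport_algebras[OF A m] .
    have "(\<lambda>N. sc n (transport (transport A (m N)) (g, h)) t) \<longlonglongrightarrow> sc n (transport B (g, h)) t"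
      if "t \<in> idx n" for t
    proof -
      obtain i j k where t: "t = (i, j, k)" "i < n" "j < n" "k < n" using \<open>t \<in> idx n\<close> by (auto simp: idx_def)
      have "(\<lambda>N. \<Sum>c<n. g $$ (k, c) * (\<Sum>a<n. \<Sum>b<n. h $$ (a, i) * h $$ (b, j) * sc n (transport A (m N)) (a, b, c)))
        \<longlonglongrightarrow> (\<Sum>c<n. g $$ (k, c) * (\<Sum>a<n. \<Sum>b<n. h $$ (a, i) * h $$ (b, j) * sc n B (a, b, c)))"
        by (intro tendsto_sum tendsto_mult tendsto_const lim) (auto simp: idx_def)
      then show ?thesis
        unfolding t(1) sc_transport[OF TA gh' t(2-4)] sc_transport[OF B gh' t(2-4)] .
    qed
    then have "(\<lambda>N. p (sc n (transport (transport A (m N)) (g, h)))) \<longlonglongrightarrow> p (orb_map n B s)"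
      unfolding orb_map_def gh by (rule poly_in_tendsto[OF p])
    moreover have "p (sc n (transport (transport A (m N)) (g, h))) = 0" for N
    proof -
      have "transport (transport A (m N)) (g, h) \<in> orb n A"
        using orb_trans[OF A transport_in_orb[OF A m] transport_in_orb[OF TA gh']] .
      then show ?thesis using vanishes_on_orb_iff[OF A p] z by blast
    qed
    ultimately show ?thesis by (simp add: LIMSEQ_const_iff)
  qed
  then show ?thesis using A B unfolding degenerates_iff by (auto simp: fun_eq_iff)
qed

lemma degenerates_transport:
  assumes A: "A \<in> algebras n" and m: "m \<in> GL_pairs n" and deg: "degenerates n (transport A m) B"
  shows "degenerates n A B"
proof -
  have T: "transport A m \<in> algebras n" by (rule transport_algebras[OF A m])
  have "p \<circ> orb_map n (transport A m) = 0" if p: "p \<in> poly_in (idx n)" and z: "p \<circ> orb_map n A = 0" for p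
  proof -
    have "\<forall>C\<in>orb n (transport A m). p (sc n C) = 0"
      using z unfolding vanishes_on_orb_iff[OF A p, symmetric]
      using orb_trans[OF A transport_in_orb[OF A m]] by blast
    then show ?thesis unfolding vanishes_on_orb_iff[OF T p] .
  qed
  then show ?thesis using deg A unfolding degenerates_iff by blast
qed

section \<open>Diagonal changes of basis\<close>

definition diag_of :: "nat \<Rightarrow> (nat \<Rightarrow> complex) \<Rightarrow> complex mat" where
  "diag_of n d = mat n n (\<lambda>(i, j). if i = j then d i else 0)"

lemma diag_of_GL:
  assumes "\<And>i. d i \<noteq> 0"
  shows "(diag_of n (\<lambda>i. inverse (d i)), diag_of n d) \<in> GL_pairs n"
  using assms
  by (auto simp: GL_pairs_def diag_of_def scalar_prod_def if_distrib[where f = "\<lambda>x. _ * x"]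
      if_distrib[where f = "\<lambda>x. x * _"] cong: if_cong intro!: eq_matI)

lemma sc_transport_diag:
  assumes A: "A \<in> algebras n" and d: "\<And>i. d i \<noteq> 0" and "i < n" "j < n" "k < n"
  shows "sc n (transport A (diag_of n (\<lambda>i. inverse (d i)), diag_of n d)) (i, j, k)
    = d i * d j / d k * sc n A (i, j, k)"
proof -
  have delta: "(\<Sum>c<n. diag_of n e $$ (k, c) * F c) = e k * F k"
    "(\<Sum>c<n. diag_of n e $$ (c, k) * F c) = e k * F k" if "k < n" for e F and k
  proof -
    have "(\<Sum>c<n. diag_of n e $$ (k, c) * F c) = (\<Sum>c<n. if c = k then e k * F k else 0)"
      "(\<Sum>c<n. diag_of n e $$ (c, k) * F c) = (\<Sum>c<n. if c = k then e k * F k else 0)"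
      by (intro sum.cong refl; use that in \<open>simp add: diag_of_def\<close>)+
    then show "(\<Sum>c<n. diag_of n e $$ (k, c) * F c) = e k * F k"
      "(\<Sum>c<n. diag_of n e $$ (c, k) * F c) = e k * F k" using that by simp_all
  qed
  show ?thesis
    unfolding sc_transport[OF A diag_of_GL[OF d] assms(3-5)] mult.assoc sum_distrib_left[symmetric]
      delta(2)[OF assms(4)] delta(2)[OF assms(3)] delta(1)[OF assms(5)]
    by (simp add: field_simps)
qed

text \<open>The degeneration along the basis \<open>t\<^bsup>w i\<^esup> e\<^sub>i\<close>, \<open>t \<rightarrow> 0\<close>.\<close>

lemma degenerates_weights:
  fixes w :: "nat \<Rightarrow> nat"
  assumes A: "A \<in> algebras n" and B: "B \<in> algebras n"
    and low: "\<And>i j k. i < n \<Longrightarrow> j < n \<Longrightarrow> k < n \<Longrightarrow> w i + w j < w k \<Longrightarrow> sc n A (i, j, k) = 0"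
    and lead: "\<And>i j k. i < n \<Longrightarrow> j < n \<Longrightarrow> k < n \<Longrightarrow>
      sc n B (i, j, k) = (if w i + w j = w k then sc n A (i, j, k) else 0)"
  shows "degenerates n A B"
proof -
  \<comment> \<open>The parameter t runs through 1, 1/2, 1/3, and so on; the successor keeps it
    meaningful and non-zero from \<open>N = 0\<close> on.\<close>
  define \<epsilon> :: "nat \<Rightarrow> complex" where "\<epsilon> N = inverse (of_nat (Suc N))" for N
  have nz: "\<epsilon> N \<noteq> 0" for N unfolding \<epsilon>_def by (simp del: of_nat_Suc)
  have \<epsilon>: "\<epsilon> \<longlonglongrightarrow> 0" unfolding \<epsilon>_def by (rule LIMSEQ_Suc[OF lim_inverse_n])
  define m where "m N = (diag_of n (\<lambda>i. inverse (\<epsilon> N ^ w i)), diag_of n (\<lambda>i. \<epsilon> N ^ w i))" for N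
  show ?thesis
  proof (rule degenerates_limit[OF A B])
    show "m N \<in> GL_pairs n" for N unfolding m_def by (rule diag_of_GL) (use nz in simp)
    fix t assume "t \<in> idx n"
    then obtain i j k where t: "t = (i, j, k)" "i < n" "j < n" "k < n" by (auto simp: idx_def)
    have eq: "sc n (transport A (m N)) t = \<epsilon> N ^ w i * \<epsilon> N ^ w j / \<epsilon> N ^ w k * sc n A (i, j, k)" for N
      unfolding m_def t(1) by (rule sc_transport_diag[OF A _ t(2-4)]) (use nz in simp)
    consider "w i + w j < w k" | "w i + w j = w k" | "w k < w i + w j" by linarith
    then show "(\<lambda>N. sc n (transport A (m N)) t) \<longlonglongrightarrow> sc n B t"
    proof cases
      case 1
      then show ?thesis using low[OF t(2-4)] lead[OF t(2-4)] unfolding eq unfolding t(1) by simp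
    next
      case 2
      then have "sc n (transport A (m N)) t = sc n B t" for N
        unfolding eq using nz[of N] lead[OF t(2-4)] by (simp add: t(1) flip: power_add)
      then show ?thesis by simp
    next
      case 3
      have "\<epsilon> N ^ w i * \<epsilon> N ^ w j / \<epsilon> N ^ w k = \<epsilon> N ^ (w i + w j - w k)" for N
        using nz[of N] 3 by (simp add: power_diff power_add)
      moreover have "(\<lambda>N. \<epsilon> N ^ (w i + w j - w k) * sc n A (i, j, k)) \<longlonglongrightarrow> 0 ^ (w i + w j - w k) * sc n A (i, j, k)"
        by (intro tendsto_intros \<epsilon>)
      moreover have "(0 :: complex) ^ (w i + w j - w k) = 0" using 3 by (simp add: power_0_left)
      ultimately show ?thesis using 3 lead[OF t(2-4)] unfolding eq unfolding t(1) by simp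
    qed
  qed
qed

section \<open>Completing a basis\<close>

text \<open>Steinitz exchange in matrix form: a non-zero coordinate \<open>k\<close> lets
  \<open>v\<close> enter the basis, and \<open>j \<le> k\<close> leaves the vectors before position
  \<open>j\<close> untouched.\<close>

lemma exchange:
  assumes gh: "(g, h) \<in> GL_pairs n" and v: "v \<in> carrier_vec n"
    and jk: "j \<le> k" "k < n" and nz: "(g *\<^sub>v v) $ k \<noteq> 0"
  obtains g' h' where "(g', h') \<in> GL_pairs n" "h' *\<^sub>v unit_vec n j = v"
    "\<And>i. i < j \<Longrightarrow> h' *\<^sub>v unit_vec n i = h *\<^sub>v unit_vec n i"
proof -
  note G = GL_pairsD[OF gh]
  define w where "w = g *\<^sub>v v"
  have w: "w \<in> carrier_vec n" using G v by (auto simp: w_def)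
  \<comment> \<open>Column \<open>j\<close> is \<open>v\<close> in the old coordinates. If
    \<open>k\<close> differs from \<open>j\<close>, column \<open>k\<close> receives the displaced
    vector number \<open>j\<close>, so that the vector dropped is number \<open>k\<close>.\<close>
  define E where "E = mat n n (\<lambda>(r, c). if c = j then w $ r
    else if c = k then (if r = j then 1 else 0) else if r = c then 1 else (0 :: complex))"
  have E: "E \<in> carrier_mat n n" by (simp add: E_def)
  have Ej: "E *\<^sub>v unit_vec n j = w"
    using w jk by (auto simp: mult_unit_vec_index[OF E] intro!: eq_vecI) (auto simp: E_def)
  have Ei: "E *\<^sub>v unit_vec n i = unit_vec n i" if "i < j" for i
    using E jk that by (intro eq_vecI) (simp_all add: mult_unit_vec_index[OF E], auto simp: E_def unit_vec_def)
  have "det E \<noteq> 0"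
  proof
    assume "det E = 0"
    then obtain u where u: "u \<in> carrier_vec n" "u \<noteq> 0\<^sub>v n" "E *\<^sub>v u = 0\<^sub>v n"
      using det_0_iff_vec_prod_zero_field[OF E] by auto
    have Eu: "w $ r * u $ j + (if r = j \<and> k \<noteq> j then u $ k else 0) + (if r \<noteq> j \<and> r \<noteq> k then u $ r else 0) = 0"
      if r: "r < n" for r
    proof -
      have "0 = (E *\<^sub>v u) $ r" using u r by simp
      also have "\<dots> = (\<Sum>c<n. E $$ (r, c) * u $ c)"
        using E u(1) r by (simp add: scalar_prod_def lessThan_atLeast0)
      also have "\<dots> = (\<Sum>c<n. (if c = j then w $ r * u $ j else 0) + (if c = k then (if r = j \<and> k \<noteq> j then u $ k else 0) else 0)
          + (if c = r then (if r \<noteq> j \<and> r \<noteq> k then u $ r else 0) else 0))"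
        by (rule sum.cong) (use r in \<open>auto simp: E_def\<close>)
      finally show ?thesis using jk r by (simp add: sum.distrib)
    qed
    \<comment> \<open>Row \<open>k\<close> gives \<open>u $ j = 0\<close> because
      \<open>w $ k\<close> is non-zero; then row \<open>j\<close> gives \<open>u $ k = 0\<close>,
      and each other row gives its own coordinate.\<close>
    have "u $ j = 0" using Eu[of k] nz jk by (auto simp: w_def split: if_splits)
    moreover have "u $ k = 0" using Eu[of j] jk calculation by (cases "k = j") auto
    ultimately have "u $ r = 0" if "r < n" for r using Eu[OF that] by (cases "r = j \<or> r = k") auto
    then show False using u by auto
  qed
  then have "det (h * E) \<noteq> 0"
    using det_mult[OF G(2) E] GL_pairs_det[of h g n] gh by (auto simp: GL_pairs_def)
  then obtain g' where "(h * E, g') \<in> GL_pairs n" using GL_pairs_exists[of "h * E" n] G E by auto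
  then have "(g', h * E) \<in> GL_pairs n" by (auto simp: GL_pairs_def)
  moreover have "(h * E) *\<^sub>v unit_vec n j = v"
    using G(2,5) E Ej v by (simp add: assoc_mult_mat_vec w_def GL_pairsD(6)[OF gh])
  moreover have "(h * E) *\<^sub>v unit_vec n i = h *\<^sub>v unit_vec n i" if "i < j" for i
    using G(2) E Ei[OF that] by (simp add: assoc_mult_mat_vec)
  ultimately show ?thesis using that by blast
qed

lemma basis1:
  assumes "x \<in> carrier_vec n" "x \<noteq> 0\<^sub>v n"
  obtains g h where "(g, h) \<in> GL_pairs n" "h *\<^sub>v unit_vec n 0 = x"
proof -
  have I: "(1\<^sub>m n, 1\<^sub>m n) \<in> GL_pairs n" by (auto simp: GL_pairs_def)
  obtain k where "k < n" "x $ k \<noteq> 0" using assms by (metis carrier_vecD eq_vecI index_zero_vec)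
  then show ?thesis using exchange[OF I assms(1), of 0 k] that assms(1) by auto
qed

lemma basis2:
  assumes x: "x \<in> carrier_vec n" "x \<noteq> 0\<^sub>v n" and y: "y \<in> carrier_vec n" "\<And>c. y \<noteq> c \<cdot>\<^sub>v x"
  obtains g h where "(g, h) \<in> GL_pairs n" "h *\<^sub>v unit_vec n 0 = x" "h *\<^sub>v unit_vec n 1 = y"
proof -
  obtain g h where gh: "(g, h) \<in> GL_pairs n" "h *\<^sub>v unit_vec n 0 = x" using basis1[OF x] .
  note G = GL_pairsD[OF gh(1)]
  have gy: "g *\<^sub>v y \<in> carrier_vec n" using G y by auto
  have "\<exists>k\<ge>1. k < n \<and> (g *\<^sub>v y) $ k \<noteq> 0"
  proof (rule ccontr)
    assume "\<not> ?thesis"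
    then have "g *\<^sub>v y = (g *\<^sub>v y) $ 0 \<cdot>\<^sub>v unit_vec n 0"
      using gy G(1) by (intro eq_vecI) (auto simp: unit_vec_def Suc_le_eq)
    then have "h *\<^sub>v (g *\<^sub>v y) = h *\<^sub>v ((g *\<^sub>v y) $ 0 \<cdot>\<^sub>v unit_vec n 0)" by (rule arg_cong)
    also have "\<dots> = (g *\<^sub>v y) $ 0 \<cdot>\<^sub>v x"
      using mult_mat_vec[OF G(2), of "unit_vec n 0"] gh(2) by simp
    finally show False using y G(6)[OF y(1)] by metis
  qed
  then obtain k where "1 \<le> k" "k < n" "(g *\<^sub>v y) $ k \<noteq> 0" by blast
  then obtain g' h' where "(g', h') \<in> GL_pairs n" "h' *\<^sub>v unit_vec n 1 = y"
    "\<And>i. i < 1 \<Longrightarrow> h' *\<^sub>v unit_vec n i = h *\<^sub>v unit_vec n i"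
    using exchange[OF gh(1) y(1)] by metis
  then show ?thesis using that gh by simp
qed

lemma basis3:
  assumes x: "x \<in> carrier_vec n" "x \<noteq> 0\<^sub>v n" and y: "y \<in> carrier_vec n" "\<And>c. y \<noteq> c \<cdot>\<^sub>v x"
    and z: "z \<in> carrier_vec n" "\<And>a b. z \<noteq> a \<cdot>\<^sub>v x + b \<cdot>\<^sub>v y"
  obtains g h where "(g, h) \<in> GL_pairs n" "h *\<^sub>v unit_vec n 0 = x" "h *\<^sub>v unit_vec n 1 = y"
    "h *\<^sub>v unit_vec n 2 = z"
proof -
  obtain g h where gh: "(g, h) \<in> GL_pairs n" "h *\<^sub>v unit_vec n 0 = x" "h *\<^sub>v unit_vec n 1 = y"
    using basis2[OF x y] .
  note G = GL_pairsD[OF gh(1)]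
  have gz: "g *\<^sub>v z \<in> carrier_vec n" using G z by auto
  have "\<exists>k\<ge>2. k < n \<and> (g *\<^sub>v z) $ k \<noteq> 0"
  proof (rule ccontr)
    assume *: "\<not> ?thesis"
    let ?a = "(g *\<^sub>v z) $ 0" and ?b = "(g *\<^sub>v z) $ 1"
    have "g *\<^sub>v z = ?a \<cdot>\<^sub>v unit_vec n 0 + ?b \<cdot>\<^sub>v unit_vec n 1"
    proof (rule eq_vecI)
      fix k assume "k < dim_vec (?a \<cdot>\<^sub>v unit_vec n 0 + ?b \<cdot>\<^sub>v unit_vec n 1)"
      then have k: "k < n" by simp
      consider "k = 0" | "k = 1" | "2 \<le> k" by linarith
      then show "(g *\<^sub>v z) $ k = (?a \<cdot>\<^sub>v unit_vec n 0 + ?b \<cdot>\<^sub>v unit_vec n 1) $ k"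
        using k * by cases (auto simp: unit_vec_def)
    qed (use G(1) in simp)
    then have "h *\<^sub>v (g *\<^sub>v z) = h *\<^sub>v (?a \<cdot>\<^sub>v unit_vec n 0 + ?b \<cdot>\<^sub>v unit_vec n 1)"
      by (rule arg_cong)
    also have "\<dots> = ?a \<cdot>\<^sub>v x + ?b \<cdot>\<^sub>v y"
      using G(2) gh(2,3) by (simp add: mult_add_distrib_mat_vec mult_mat_vec)
    finally show False using z G(6)[OF z(1)] by metis
  qed
  then obtain k where "2 \<le> k" "k < n" "(g *\<^sub>v z) $ k \<noteq> 0" by blast
  then obtain g' h' where "(g', h') \<in> GL_pairs n" "h' *\<^sub>v unit_vec n 2 = z"
    "\<And>i. i < 2 \<Longrightarrow> h' *\<^sub>v unit_vec n i = h *\<^sub>v unit_vec n i"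
    using exchange[OF gh(1) z(1)] by metis
  then show ?thesis using that gh by simp
qed

section \<open>Algebras of level one\<close>

definition zero_alg :: "nat \<Rightarrow> mult \<Rightarrow> bool" where
  "zero_alg n A \<longleftrightarrow> (\<forall>t\<in>idx n. sc n A t = 0)"

text \<open>Not rigidity in the sense of an open orbit: at most one orbit, that of the zero algebra,
  lies properly below. The zero algebra itself qualifies.\<close>

definition rigid :: "nat \<Rightarrow> mult \<Rightarrow> bool" where
  "rigid n A \<longleftrightarrow> A \<in> algebras n \<and> (\<forall>B. degenerates n A B \<longrightarrow> zero_alg n B \<or> alg_iso n A B)"

lemma sc_mult_table:
  assumes "i < n" "j < n" "k < n" "t i j \<in> carrier_vec n"
  shows "sc n (mult_table n t) (i, j, k) = t i j $ k"
  using assms by (simp add: sc_def mult_table_unit_vec)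

lemma sc_alg_sum_abelian:
  assumes m: "m \<le> n" and t: "\<And>i j. i < m \<Longrightarrow> j < m \<Longrightarrow> t i j \<in> carrier_vec m"
    and ijk: "i < n" "j < n" "k < n"
  shows "sc n (alg_sum m (n - m) (mult_table m t) (abelian (n - m))) (i, j, k) =
    (if i < m \<and> j < m \<and> k < m then t i j $ k else 0)"
proof -
  let ?u = "\<lambda>i. vec_first (unit_vec n i :: complex vec) m"
  have u: "?u i = (if i < m then unit_vec m i else 0\<^sub>v m)" if "i < n" for i
    using that m by (auto simp: vec_first_def unit_vec_def)
  have car: "mult_table m t x y \<in> carrier_vec m" for x y by (simp add: mult_table_def)
  have z: "mult_table m t (0\<^sub>v m) y = 0\<^sub>v m" "mult_table m t y (0\<^sub>v m) = 0\<^sub>v m" for y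
    by (auto simp: mult_table_def)
  have "sc n (alg_sum m (n - m) (mult_table m t) (abelian (n - m))) (i, j, k) =
    (if k < m then mult_table m t (?u i) (?u j) $ k else 0)"
    using ijk m car by (simp add: sc_def alg_sum_def abelian_def mult_table_def)
  also have "\<dots> = (if i < m \<and> j < m \<and> k < m then t i j $ k else 0)"
    using ijk t by (auto simp: u z mult_table_unit_vec)
  finally show ?thesis .
qed

lemma sc_transport_basis:
  assumes A: "A \<in> algebras n" and gh: "(g, h) \<in> GL_pairs n" and "i < n" "j < n" "k < n"
    and v: "A (h *\<^sub>v unit_vec n i) (h *\<^sub>v unit_vec n j) = h *\<^sub>v v" "v \<in> carrier_vec n"
  shows "sc n (transport A (g, h)) (i, j, k) = v $ k"
  using assms GL_pairsD(5)[OF gh v(2)] by (simp add: sc_def transport_def)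

text \<open>The common pattern of all cases: after a change of basis the weights produce a limit
  \<open>B\<close>, and the index \<open>t\<close> witnesses that \<open>B\<close> is non-zero,
  which leaves only the isomorphism.\<close>

lemma rigid_degeneration:
  assumes rig: "rigid n A" and gh: "(g, h) \<in> GL_pairs n" and B: "B \<in> algebras n"
    and low: "\<And>i j k. i < n \<Longrightarrow> j < n \<Longrightarrow> k < n \<Longrightarrow> w i + w j < w k \<Longrightarrow>
      sc n (transport A (g, h)) (i, j, k) = 0"
    and lead: "\<And>i j k. i < n \<Longrightarrow> j < n \<Longrightarrow> k < n \<Longrightarrow>
      sc n B (i, j, k) = (if w i + w j = (w k :: nat) then sc n (transport A (g, h)) (i, j, k) else 0)"
    and nz: "t \<in> idx n" "sc n B t \<noteq> 0"
  shows "alg_iso n A B"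
proof -
  have A: "A \<in> algebras n" using rig by (simp add: rigid_def)
  have "degenerates n A B"
    using degenerates_weights[OF transport_algebras[OF A gh] B low lead] degenerates_transport[OF A gh] by blast
  then show ?thesis using rig nz unfolding rigid_def zero_alg_def by blast
qed

lemma algebra_zero_mult:
  assumes A: "A \<in> algebras n" and y: "y \<in> carrier_vec n"
  shows "A (0\<^sub>v n) y = 0\<^sub>v n"
proof -
  have "A (0 \<cdot>\<^sub>v 0\<^sub>v n) y = 0 \<cdot>\<^sub>v A (0\<^sub>v n) y" using algebrasD(5)[OF A _ y] by simp
  moreover have "0 \<cdot>\<^sub>v 0\<^sub>v n = (0\<^sub>v n :: complex vec)" by auto
  moreover have "0 \<cdot>\<^sub>v A (0\<^sub>v n) y = 0\<^sub>v n" using algebrasD(1)[OF A _ y, of "0\<^sub>v n"] by auto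
  ultimately show ?thesis by simp
qed

text \<open>With weights 1, 2, 2, ... no sum of two weights is below a third weight, so nothing has
  to vanish beforehand. Equality occurs only in the square of the first basis vector, and this
  square was chosen as the second one.\<close>

lemma rigid_lambda2:
  assumes n: "n \<ge> 2" and rig: "rigid n A" and x: "x \<in> carrier_vec n" "\<And>c. A x x \<noteq> c \<cdot>\<^sub>v x"
  shows "alg_iso n A (alg_sum 2 (n - 2) lambda2 (abelian (n - 2)))"
proof -
  have A: "A \<in> algebras n" using rig by (simp add: rigid_def)
  have x0: "x \<noteq> 0\<^sub>v n"
  proof
    assume "x = 0\<^sub>v n"
    then have "A x x = 0 \<cdot>\<^sub>v x" using algebra_zero_mult[OF A] by auto
    then show False using x by blast
  qed
  obtain g h where gh: "(g, h) \<in> GL_pairs n" "h *\<^sub>v unit_vec n 0 = x" "h *\<^sub>v unit_vec n 1 = A x x"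
    using basis2[OF x(1) x0 algebrasD(1)[OF A x(1) x(1)] x(2)] .
  let ?B = "alg_sum 2 (n - 2) lambda2 (abelian (n - 2))"
  have B: "?B \<in> algebras n"
    using alg_sum_algebras[OF mult_table_algebras[of 2] abelian_algebras[of "n - 2"]] le_add_diff_inverse[OF n]
    by (simp only: lambda2_def)
  have scB: "sc n ?B (i, j, k) = (if i = 0 \<and> j = 0 \<and> k = 1 then 1 else 0)"
    if "i < n" "j < n" "k < n" for i j k
    unfolding lambda2_def by (subst sc_alg_sum_abelian) (use n that in auto)
  have sc00: "sc n (transport A (g, h)) (0, 0, k) = (if k = 1 then 1 else 0)" if "k < n" for k
    using sc_transport_basis[OF A gh(1), of 0 0 k "unit_vec n 1"] that n gh by auto
  show ?thesis
    by (rule rigid_degeneration[OF rig gh(1) B, of "\<lambda>i. if i = 0 then 1 else 2" "(0, 0, 1)"])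
       (use n in \<open>auto simp: scB sc00 idx_def split: if_splits\<close>)
qed

text \<open>Since squares are multiples of their roots, expanding the square of \<open>x + y\<close>
  makes \<open>x\<close> and \<open>y\<close> anticommute modulo their span. The weights 1, 1, 2, 2,
  ... retain, from the products of the first two basis vectors, exactly the components outside that
  span.\<close>

lemma rigid_n3_minus:
  assumes n: "n \<ge> 3" and rig: "rigid n A"
    and sq: "\<And>x. x \<in> carrier_vec n \<Longrightarrow> \<exists>c. A x x = c \<cdot>\<^sub>v x"
    and x: "x \<in> carrier_vec n" and y: "y \<in> carrier_vec n" and xy: "\<And>a b. A x y \<noteq> a \<cdot>\<^sub>v x + b \<cdot>\<^sub>v y"
  shows "alg_iso n A (alg_sum 3 (n - 3) n3_minus (abelian (n - 3)))"
proof -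
  have A: "A \<in> algebras n" using rig by (simp add: rigid_def)
  note D = algebrasD[OF A]
  obtain c where c: "A x x = c \<cdot>\<^sub>v x" using sq[OF x] by blast
  obtain d where d: "A y y = d \<cdot>\<^sub>v y" using sq[OF y] by blast
  obtain e where e: "A (x + y) (x + y) = e \<cdot>\<^sub>v (x + y)" using sq[of "x + y"] x y by auto
  have y': "y \<noteq> a \<cdot>\<^sub>v x" for a
  proof
    assume "y = a \<cdot>\<^sub>v x"
    then have "A x y = (a * c) \<cdot>\<^sub>v x + 0 \<cdot>\<^sub>v y" using D(6)[OF x x, of a] x by (auto simp: c smult_smult_assoc)
    then show False using xy by blast
  qed
  have x0: "x \<noteq> 0\<^sub>v n"
  proof
    assume "x = 0\<^sub>v n"
    then have "A x y = 0 \<cdot>\<^sub>v x + 0 \<cdot>\<^sub>v y" using algebra_zero_mult[OF A y] y by auto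
    then show False using xy by blast
  qed
  let ?z = "A x y"
  obtain g h where gh: "(g, h) \<in> GL_pairs n" "h *\<^sub>v unit_vec n 0 = x" "h *\<^sub>v unit_vec n 1 = y"
    "h *\<^sub>v unit_vec n 2 = ?z"
    using basis3[OF x x0 y y' D(1)[OF x y] xy] .
  have h: "h \<in> carrier_mat n n" using GL_pairsD(2)[OF gh(1)] .
  have yx: "A y x = (e - c) \<cdot>\<^sub>v x + ((e - d) \<cdot>\<^sub>v y + - 1 \<cdot>\<^sub>v ?z)"
  proof (rule eq_vecI)
    fix k assume "k < dim_vec ((e - c) \<cdot>\<^sub>v x + ((e - d) \<cdot>\<^sub>v y + - 1 \<cdot>\<^sub>v ?z))"
    then have k: "k < n" using D(2)[OF x y] by simp
    have "A (x + y) (x + y) = (A x x + A x y) + (A y x + A y y)"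
      using D(3)[OF x _ y, of "x + y"] D(4)[OF x x y] D(4)[OF y x y] x y by simp
    then have "(e \<cdot>\<^sub>v (x + y)) $ k = ((c \<cdot>\<^sub>v x + ?z) + (A y x + d \<cdot>\<^sub>v y)) $ k" unfolding e c d by simp
    then show "A y x $ k = ((e - c) \<cdot>\<^sub>v x + ((e - d) \<cdot>\<^sub>v y + - 1 \<cdot>\<^sub>v ?z)) $ k"
      using x y k D(2)[OF x y] D(2)[OF y x] by (simp add: algebra_simps)
  qed (use x y D(2)[OF x y] D(2)[OF y x] in simp)
  let ?T = "transport A (g, h)"
  have 00: "sc n ?T (0, 0, k) = (if k = 0 then c else 0)" if "k < n" for k
    using sc_transport_basis[OF A gh(1), of 0 0 k "c \<cdot>\<^sub>v unit_vec n 0"] that n gh h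
    by (auto simp: c mult_mat_vec)
  have 11: "sc n ?T (1, 1, k) = (if k = 1 then d else 0)" if "k < n" for k
    using sc_transport_basis[OF A gh(1), of 1 1 k "d \<cdot>\<^sub>v unit_vec n 1"] that n gh h
    by (auto simp: d mult_mat_vec)
  have 01: "sc n ?T (0, 1, k) = (if k = 2 then 1 else 0)" if "k < n" for k
    using sc_transport_basis[OF A gh(1), of 0 1 k "unit_vec n 2"] that n gh by auto
  have 10: "sc n ?T (1, 0, k) = (if k = 2 then - 1 else 0)" if "2 \<le> k" "k < n" for k
    using sc_transport_basis[OF A gh(1), of 1 0 k "(e - c) \<cdot>\<^sub>v unit_vec n 0 + ((e - d) \<cdot>\<^sub>v unit_vec n 1 + - 1 \<cdot>\<^sub>v unit_vec n 2)"]
      that n gh h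
    by (auto simp: yx mult_mat_vec mult_add_distrib_mat_vec)
  let ?B = "alg_sum 3 (n - 3) n3_minus (abelian (n - 3))"
  have B: "?B \<in> algebras n"
    using alg_sum_algebras[OF mult_table_algebras[of 3] abelian_algebras[of "n - 3"]] le_add_diff_inverse[OF n]
    by (simp only: n3_minus_def)
  have scB: "sc n ?B (i, j, k) = (if i = 0 \<and> j = 1 \<and> k = 2 then 1 else if i = 1 \<and> j = 0 \<and> k = 2 then - 1 else 0)"
    if "i < n" "j < n" "k < n" for i j k
    unfolding n3_minus_def by (subst sc_alg_sum_abelian) (use n that in auto)
  show ?thesis
  proof (rule rigid_degeneration[OF rig gh(1) B, of "\<lambda>i. if i < 2 then 1 else 2" "(0, 1, 2)"])
    fix i j k assume ijk: "i < n" "j < n" "k < n"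
    consider "i = 0" "j = 0" | "i = 0" "j = 1" | "i = 1" "j = 0" | "i = 1" "j = 1" | "\<not> (i < 2 \<and> j < 2)"
      by linarith
    then show "sc n ?B (i, j, k) = (if (if i < 2 then 1 else 2) + (if j < 2 then 1 else 2) = (if k < 2 then 1 else 2 :: nat)
        then sc n ?T (i, j, k) else 0)"
      by cases (use ijk 10[of k] in \<open>auto simp: scB 00 01[simplified] 11[simplified]\<close>)
  qed (use n in \<open>auto simp: scB idx_def split: if_splits\<close>)
qed

text \<open>For distinct indices, \<open>G i\<close> and \<open>H j\<close> are the coefficients of
  \<open>e_j\<close> and of \<open>e_i\<close> in \<open>e_i e_j\<close>. A sum of two basis vectors
  in one factor shows that each depends on one index only; squares of sums and differences settle
  the diagonal.\<close>

lemma span_product_form: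
  assumes n: "n \<ge> 3" and A: "A \<in> algebras n"
    and sq: "\<And>x. x \<in> carrier_vec n \<Longrightarrow> \<exists>c. A x x = c \<cdot>\<^sub>v x"
    and span: "\<And>x y. x \<in> carrier_vec n \<Longrightarrow> y \<in> carrier_vec n \<Longrightarrow> \<exists>a b. A x y = a \<cdot>\<^sub>v x + b \<cdot>\<^sub>v y"
  obtains G H where "\<And>i j k. i < n \<Longrightarrow> j < n \<Longrightarrow> k < n \<Longrightarrow>
    sc n A (i, j, k) = (if j = k then G i else 0) + (if i = k then H j else 0)"
proof -
  note D = algebrasD[OF A]
  let ?e = "unit_vec n :: nat \<Rightarrow> complex vec"
  let ?s = "\<lambda>i j k. sc n A (i, j, k)"
  have off: "?s i j k = 0" if "i < n" "j < n" "k < n" "k \<noteq> i" "k \<noteq> j" for i j k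
  proof -
    obtain a b where "A (?e i) (?e j) = a \<cdot>\<^sub>v ?e i + b \<cdot>\<^sub>v ?e j" using span by (metis unit_vec_carrier)
    then show ?thesis using that by (simp add: sc_def)
  qed
  \<comment> \<open>The coefficients of \<open>e_i\<close> and \<open>e_l\<close> in
    \<open>(e_i + e_l) e_j\<close> agree by \<open>span\<close>, and the mixed contributions vanish
    by \<open>off\<close>.\<close>
  have H': "?s i j i = ?s l j l" if "i < n" "l < n" "j < n" "i \<noteq> j" "l \<noteq> j" for i l j
  proof (cases "i = l")
    case False
    obtain a b where ab: "A (?e i + ?e l) (?e j) = a \<cdot>\<^sub>v (?e i + ?e l) + b \<cdot>\<^sub>v ?e j"
      using span[of "?e i + ?e l" "?e j"] by auto
    have "A (?e i) (?e j) + A (?e l) (?e j) = a \<cdot>\<^sub>v (?e i + ?e l) + b \<cdot>\<^sub>v ?e j"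
      using ab D(3)[of "?e i" "?e j" "?e l"] by simp
    from arg_cong[OF this, of "\<lambda>v. v $ i"] arg_cong[OF this, of "\<lambda>v. v $ l"]
    have "?s i j i + ?s l j i = a" "?s i j l + ?s l j l = a"
      using that False D(2)[of "?e i" "?e j"] D(2)[of "?e l" "?e j"] by (simp_all add: sc_def)
    then show ?thesis using off[of l j i] off[of i j l] that False by simp
  qed simp
  have G': "?s j i i = ?s j l l" if "i < n" "l < n" "j < n" "i \<noteq> j" "l \<noteq> j" for i l j
  proof (cases "i = l")
    case False
    obtain a b where ab: "A (?e j) (?e i + ?e l) = a \<cdot>\<^sub>v ?e j + b \<cdot>\<^sub>v (?e i + ?e l)"
      using span[of "?e j" "?e i + ?e l"] by auto
    have "A (?e j) (?e i) + A (?e j) (?e l) = a \<cdot>\<^sub>v ?e j + b \<cdot>\<^sub>v (?e i + ?e l)"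
      using ab D(4)[of "?e j" "?e i" "?e l"] by simp
    from arg_cong[OF this, of "\<lambda>v. v $ i"] arg_cong[OF this, of "\<lambda>v. v $ l"]
    have "?s j i i + ?s j l i = b" "?s j i l + ?s j l l = b"
      using that False D(2)[of "?e j" "?e i"] D(2)[of "?e j" "?e l"] by (simp_all add: sc_def)
    then show ?thesis using off[of j l i] off[of j i l] that False by simp
  qed simp
  \<comment> \<open>\<open>o' i\<close> is some index other than \<open>i\<close>; by
    \<open>G'\<close> and \<open>H'\<close> any other choice gives the same \<open>G\<close> and
    \<open>H\<close>.\<close>
  define o' where "o' i = (if i = 0 then 1 else 0 :: nat)" for i :: nat
  have o': "o' i < n" "o' i \<noteq> i" for i using n by (auto simp: o'_def)
  define G where "G i = ?s i (o' i) (o' i)" for i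
  define H where "H j = ?s (o' j) j (o' j)" for j
  have G: "?s i j j = G i" and H: "?s j i j = H i" if "i < n" "j < n" "i \<noteq> j" for i j
    using G'[of j "o' i" i] H'[of j "o' i" i] o'[of i] that by (auto simp: G_def H_def)
  have diag: "?s i i i = G i + H i" if i: "i < n" for i
  proof -
    define j where "j = o' i"
    have j: "j < n" "j \<noteq> i" using o' by (auto simp: j_def)
    have dims: "dim_vec (A (?e a) (?e b)) = n" for a b using D(2) by simp
    obtain a where "A (?e i + ?e j) (?e i + ?e j) = a \<cdot>\<^sub>v (?e i + ?e j)" using sq[of "?e i + ?e j"] by auto
    then have "(A (?e i) (?e i) + A (?e i) (?e j)) + (A (?e j) (?e i) + A (?e j) (?e j)) = a \<cdot>\<^sub>v (?e i + ?e j)"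
      using D(3)[of "?e i" "?e i + ?e j" "?e j"] D(4) by simp
    from arg_cong[OF this, of "\<lambda>v. v $ i"] arg_cong[OF this, of "\<lambda>v. v $ j"]
    have 1: "?s i i i + ?s i j i + ?s j i i + ?s j j i = a" "?s i i j + ?s i j j + ?s j i j + ?s j j j = a"
      using i j dims by (simp_all add: sc_def add.assoc)
    \<comment> \<open>The square of the sum only ties \<open>?s i i i\<close> to
      \<open>?s j j j\<close>. The square of the difference gives a second relation with opposite
      signs at \<open>j\<close>, and adding the two eliminates \<open>?s j j j\<close>.\<close>
    obtain b where "A (?e i + - 1 \<cdot>\<^sub>v ?e j) (?e i + - 1 \<cdot>\<^sub>v ?e j) = b \<cdot>\<^sub>v (?e i + - 1 \<cdot>\<^sub>v ?e j)"
      using sq[of "?e i + - 1 \<cdot>\<^sub>v ?e j"] by auto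
    then have "(A (?e i) (?e i) + - 1 \<cdot>\<^sub>v A (?e i) (?e j)) + (- 1 \<cdot>\<^sub>v A (?e j) (?e i) + - 1 \<cdot>\<^sub>v (- 1 \<cdot>\<^sub>v A (?e j) (?e j)))
        = b \<cdot>\<^sub>v (?e i + - 1 \<cdot>\<^sub>v ?e j)"
      using D(3)[of "?e i" "?e i + - 1 \<cdot>\<^sub>v ?e j" "- 1 \<cdot>\<^sub>v ?e j"] D(4,5,6) by simp
    from arg_cong[OF this, of "\<lambda>v. v $ i"] arg_cong[OF this, of "\<lambda>v. v $ j"]
    have 2: "?s i i i - ?s i j i - ?s j i i + ?s j j i = b" "?s i i j - ?s i j j - ?s j i j + ?s j j j = - b"
      using i j dims by (simp_all add: sc_def algebra_simps)
    have z: "?s j j i = 0" "?s i i j = 0" using off i j by auto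
    have "?s i i i + H j + G j = ?s j j j + G i + H i" "?s i i i - H j - G j = - (?s j j j - G i - H i)"
      using 1 2 z G[OF i j(1)] G[OF j(1) i] H[OF i j(1)] H[OF j(1) i] j by (auto simp: algebra_simps)
    from arg_cong2[OF this, of "(+)"] have "2 * ?s i i i = 2 * (G i + H i)"
      by (simp add: algebra_simps)
    then show ?thesis by (simp only: mult_cancel_left) simp
  qed
  show ?thesis
  proof (rule that)
    fix i j k assume "i < n" "j < n" "k < n"
    then show "?s i j k = (if j = k then G i else 0) + (if i = k then H j else 0)"
      using off[of i j k] G[of i j] H[of j i] diag[of i] by (cases "i = j") auto
  qed
qed

lemma rigid_span_product:
  assumes n: "n \<ge> 3" and rig: "rigid n A" and nz: "\<not> zero_alg n A"
    and form: "\<And>i j k. i < n \<Longrightarrow> j < n \<Longrightarrow> k < n \<Longrightarrow>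
      sc n A (i, j, k) = (if j = k then G i else 0) + (if i = k then H j else 0)"
  shows "alg_iso n A (p_minus n) \<or> (\<exists>\<alpha>. alg_iso n A (nu n \<alpha>))"
proof -
  have A: "A \<in> algebras n" using rig by (simp add: rigid_def)
  define \<gamma> where "\<gamma> x = (\<Sum>i<n. x $ i * G i)" for x :: "complex vec"
  define \<eta> where "\<eta> x = (\<Sum>i<n. x $ i * H i)" for x :: "complex vec"
  have prod: "A x y = \<gamma> x \<cdot>\<^sub>v y + \<eta> y \<cdot>\<^sub>v x" if x: "x \<in> carrier_vec n" and y: "y \<in> carrier_vec n" for x y
  proof (rule eq_vecI)
    fix k assume "k < dim_vec (\<gamma> x \<cdot>\<^sub>v y + \<eta> y \<cdot>\<^sub>v x)"
    then have k: "k < n" using x by simp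
    have "A x y $ k = (\<Sum>i<n. \<Sum>j<n. (if j = k then x $ i * y $ j * G i else 0) + (if i = k then x $ i * y $ j * H j else 0))"
      unfolding algebra_expand[OF A x y k] using k form by (intro sum.cong refl) (simp add: algebra_simps)
    also have "\<dots> = (\<Sum>i<n. x $ i * y $ k * G i) + (\<Sum>i<n. if i = k then \<Sum>j<n. x $ i * y $ j * H j else 0)"
      unfolding sum.distrib using k by (intro arg_cong2[of _ _ _ _ "(+)"] sum.cong refl) auto
    also have "\<dots> = (\<gamma> x \<cdot>\<^sub>v y + \<eta> y \<cdot>\<^sub>v x) $ k"
      using k x y by (simp add: \<gamma>_def \<eta>_def sum_distrib_left sum_distrib_right mult_ac)
    finally show "A x y $ k = (\<gamma> x \<cdot>\<^sub>v y + \<eta> y \<cdot>\<^sub>v x) $ k" .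
  qed (use x y algebrasD(2)[OF A x y] in simp)
  obtain i where i: "i < n" "G i \<noteq> 0 \<or> H i \<noteq> 0"
    using nz form unfolding zero_alg_def idx_def by (force split: if_splits)
  \<comment> \<open>The scaling yields \<open>\<gamma> x + \<eta> x = 1\<close>, as in
    \<open>nu\<close>, or, if the sum of the forms vanishes, \<open>\<gamma> x = 1\<close> and
    \<open>\<eta> x = - 1\<close>, as in \<open>p_minus\<close>.\<close>
  define c where "c = (if G i + H i = 0 then 1 / G i else 1 / (G i + H i))"
  define x where "x = c \<cdot>\<^sub>v unit_vec n i"
  have c0: "c \<noteq> 0" using i by (auto simp: c_def)
  have "x $ i \<noteq> 0" using c0 i by (simp add: x_def)
  then have x: "x \<in> carrier_vec n" "x \<noteq> 0\<^sub>v n" using i(1) by (simp add: x_def, auto)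
  have gx: "\<gamma> x = c * G i" "\<eta> x = c * H i"
    using i by (simp_all add: \<gamma>_def \<eta>_def x_def unit_vec_def if_distrib[where f = "\<lambda>x. _ * x"]
        if_distrib[where f = "\<lambda>x. x * _"] cong: if_cong)
  obtain g h where gh: "(g, h) \<in> GL_pairs n" "h *\<^sub>v unit_vec n 0 = x" using basis1[OF x] .
  note hc = GL_pairsD(2)[OF gh(1)]
  let ?T = "transport A (g, h)" and ?w = "\<lambda>i. if i = 0 then 0 else 1 :: nat"
  define G' where "G' j = \<gamma> (h *\<^sub>v unit_vec n j)" for j
  define H' where "H' j = \<eta> (h *\<^sub>v unit_vec n j)" for j
  have T: "sc n ?T (i, j, k) = (if j = k then G' i else 0) + (if i = k then H' j else 0)"
    if ijk: "i < n" "j < n" "k < n" for i j k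
  proof -
    have "A (h *\<^sub>v unit_vec n i) (h *\<^sub>v unit_vec n j) = h *\<^sub>v (G' i \<cdot>\<^sub>v unit_vec n j + H' j \<cdot>\<^sub>v unit_vec n i)"
      using hc ijk by (simp add: prod G'_def H'_def mult_add_distrib_mat_vec mult_mat_vec)
    from sc_transport_basis[OF A gh(1) ijk this] show ?thesis using ijk by simp
  qed
  have GH0: "G' 0 = c * G i" "H' 0 = c * H i" using gh gx by (auto simp: G'_def H'_def)
  \<comment> \<open>Only the values of the two forms on the first basis vector survive in the limit:
    on any other basis vector they enter with a weight sum that is one too large. The case split
    selects a non-zero structure constant of \<open>B\<close>.\<close>
  have key: "alg_iso n A B" if B: "B \<in> algebras n"
    and scB: "\<And>i j k. i < n \<Longrightarrow> j < n \<Longrightarrow> k < n \<Longrightarrow> sc n B (i, j, k) =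
      (if i = 0 \<and> j = k then G' 0 else 0) + (if j = 0 \<and> i = k then H' 0 else 0)" for B
  proof (cases "G' 0 = 0")
    case False
    show ?thesis
      by (rule rigid_degeneration[OF rig gh(1) B, of ?w "(0, 1, 1)"])
         (use n False in \<open>auto simp: scB T idx_def split: if_splits\<close>)
  next
    case True
    then have "H' 0 \<noteq> 0" using i c0 GH0 by auto
    show ?thesis
      by (rule rigid_degeneration[OF rig gh(1) B, of ?w "(1, 0, 1)"])
         (use n \<open>H' 0 \<noteq> 0\<close> in \<open>auto simp: scB T idx_def split: if_splits\<close>)
  qed
  show ?thesis
  proof (cases "G i + H i = 0")
    case True
    then have "H i = - G i" "G i \<noteq> 0" using i by (auto simp: add_eq_0_iff)
    then have GH: "G' 0 = 1" "H' 0 = - 1" unfolding GH0 by (auto simp: c_def)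
    have "alg_iso n A (p_minus n)"
    proof (rule key)
      show "p_minus n \<in> algebras n" unfolding p_minus_def by (rule mult_table_algebras)
      fix i j k assume ijk: "i < n" "j < n" "k < n"
      show "sc n (p_minus n) (i, j, k) =
        (if i = 0 \<and> j = k then G' 0 else 0) + (if j = 0 \<and> i = k then H' 0 else 0)"
        unfolding p_minus_def GH using ijk by (subst sc_mult_table) auto
    qed
    then show ?thesis by blast
  next
    case False
    then have "c * (G i + H i) = 1" by (simp add: c_def)
    then have GH: "H' 0 = 1 - G' 0" unfolding GH0 by (simp add: algebra_simps)
    have "alg_iso n A (nu n (G' 0))"
    proof (rule key)
      show "nu n (G' 0) \<in> algebras n" unfolding nu_def by (rule mult_table_algebras)
      fix i j k assume ijk: "i < n" "j < n" "k < n"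
      show "sc n (nu n (G' 0)) (i, j, k) =
        (if i = 0 \<and> j = k then G' 0 else 0) + (if j = 0 \<and> i = k then H' 0 else 0)"
        unfolding nu_def GH using ijk by (subst sc_mult_table) auto
    qed
    then show ?thesis by blast
  qed
qed

lemma rigid_classification:
  assumes n: "n \<ge> 3" and rig: "rigid n A" and nz: "\<not> zero_alg n A"
  shows "alg_iso n A (p_minus n) \<or>
         alg_iso n A (alg_sum 3 (n - 3) n3_minus (abelian (n - 3))) \<or>
         alg_iso n A (alg_sum 2 (n - 2) lambda2 (abelian (n - 2))) \<or>
         (\<exists>\<alpha>::complex. alg_iso n A (nu n \<alpha>))"
proof (cases "\<exists>x\<in>carrier_vec n. \<forall>c. A x x \<noteq> c \<cdot>\<^sub>v x")
  case True
  then show ?thesis using rigid_lambda2[OF _ rig] n by auto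
next
  case sq: False
  show ?thesis
  proof (cases "\<exists>x\<in>carrier_vec n. \<exists>y\<in>carrier_vec n. \<forall>a b. A x y \<noteq> a \<cdot>\<^sub>v x + b \<cdot>\<^sub>v y")
    case True
    then show ?thesis using rigid_n3_minus[OF n rig] sq by blast
  next
    case False
    have "A \<in> algebras n" using rig by (simp add: rigid_def)
    then obtain G H where "\<And>i j k. i < n \<Longrightarrow> j < n \<Longrightarrow> k < n \<Longrightarrow>
      sc n A (i, j, k) = (if j = k then G i else 0) + (if i = k then H j else 0)"
      using span_product_form[OF n, of A] sq False by metis
    then show ?thesis using rigid_span_product[OF n rig nz] by blast
  qed
qed

section \<open>Chains of direct degenerations\<close>

lemma degenerates_abelian:
  assumes "A \<in> algebras n"
  shows "degenerates n A (abelian n)"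
  \<comment> \<open>With all weights equal to 1 every sum of two weights exceeds every weight, so
    all structure constants tend to zero.\<close>
  by (rule degenerates_weights[OF assms abelian_algebras, of "\<lambda>_. 1"]) (auto simp: sc_def abelian_def)

text \<open>The coordinate functions vanish on the orbit of a zero algebra, hence on its
  closure.\<close>

lemma zero_alg_degenerates:
  assumes deg: "degenerates n A B" and z: "zero_alg n A"
  shows "zero_alg n B"
  unfolding zero_alg_def
proof
  fix t assume t: "t \<in> idx n"
  have alg: "A \<in> algebras n" "B \<in> algebras n" using deg by (auto simp: degenerates_iff)
  have "(\<lambda>f. f t) \<circ> orb_map n A = 0"
  proof
    fix m
    obtain g h where gh: "GL_norm n m = (g, h)" by (cases "GL_norm n m")
    then have G: "(g, h) \<in> GL_pairs n" using GL_norm(1)[of n m] by simp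
    obtain i j k where t': "t = (i, j, k)" "i < n" "j < n" "k < n" using t by (auto simp: idx_def)
    show "((\<lambda>f. f t) \<circ> orb_map n A) m = 0 m"
      using z sc_transport[OF alg(1) G t'(2-4)] by (simp add: orb_map_def gh t' zero_alg_def idx_def)
  qed
  then have "\<forall>C\<in>orb n B. sc n C t = 0"
    using deg poly_in.coord[OF t] vanishes_on_orb_iff[OF alg(2) poly_in.coord[OF t]]
    unfolding degenerates_iff by blast
  moreover have "alg_iso n B B"
    unfolding alg_iso_iff using algebrasD(1)[OF alg(2)]
    by (intro bexI[of _ "(1\<^sub>m n, 1\<^sub>m n)"]) (auto simp: GL_pairs_def)
  ultimately show "sc n B t = 0" using orb_iff_alg_iso alg by blast
qed

text \<open>Among the non-trivial degenerations of \<open>A\<close> with property \<open>P\<close>,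
  one of largest orbit dimension is direct: an intermediate algebra would have \<open>P\<close> by
  \<open>up\<close> and a larger dimension. The maximum exists because \<open>orb_dim\<close> is
  bounded by the number of structure constants.\<close>

lemma direct_degen_exists:
  assumes "nontrivial_degen n A B" "P B"
    and up: "\<And>C D. nontrivial_degen n C D \<Longrightarrow> P D \<Longrightarrow> P C"
  shows "\<exists>C. direct_degen n A C \<and> P C"
proof -
  have "\<exists>C. (nontrivial_degen n A C \<and> P C) \<and>
    (\<forall>D. nontrivial_degen n A D \<and> P D \<longrightarrow> orb_dim n D \<le> orb_dim n C)"
    by (rule ex_has_greatest_nat[of _ B _ "Suc (card (idx n))"])
       (use assms(1,2) in \<open>auto intro: le_SucI le_imp_less_Suc orb_dim_le\<close>)
  then obtain C where C: "nontrivial_degen n A C" "P C"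
    and max: "\<And>D. nontrivial_degen n A D \<Longrightarrow> P D \<Longrightarrow> orb_dim n D \<le> orb_dim n C"
    by blast
  have "\<not> (\<exists>D. nontrivial_degen n A D \<and> nontrivial_degen n D C)"
    using up C max orb_dim_less by (meson not_le)
  then show ?thesis using C by (auto simp: direct_degen_def)
qed

lemma level_one_rigid:
  assumes A: "A \<in> algebras n" and lev: "level n A = 1"
  shows "rigid n A" "\<not> zero_alg n A"
proof -
  let ?K = "{enat k | k. \<exists>\<mu>. (direct_degen n ^^ k) A \<mu>}"
  have iso_zero: "alg_iso n C D" if "zero_alg n C" "zero_alg n D" "C \<in> algebras n" "D \<in> algebras n" for C D
  proof -
    have "C x y = D x y" if "x \<in> carrier_vec n" "y \<in> carrier_vec n" for x y
      by (rule algebra_eqI[OF _ _ _ that]) (use \<open>zero_alg n C\<close> \<open>zero_alg n D\<close> \<open>C \<in> _\<close> \<open>D \<in> _\<close> in \<open>auto simp: zero_alg_def\<close>)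
    then show ?thesis
      unfolding alg_iso_iff using algebrasD(1)[OF \<open>D \<in> algebras n\<close>]
      by (intro bexI[of _ "(1\<^sub>m n, 1\<^sub>m n)"]) (auto simp: GL_pairs_def)
  qed
  have zab: "zero_alg n (abelian n)" by (auto simp: zero_alg_def sc_def abelian_def idx_def)
  have two: "\<not> (direct_degen n A B \<and> direct_degen n B C)" for B C
  proof
    assume "direct_degen n A B \<and> direct_degen n B C"
    then have "(direct_degen n ^^ 2) A C" by (auto simp: numeral_2_eq_2 relcompp.simps)
    then have "enat 2 \<le> Sup ?K" by (intro Sup_upper) blast
    then show False using lev unfolding level_def by (simp add: one_enat_def)
  qed
  show nz: "\<not> zero_alg n A"
  proof
    assume z: "zero_alg n A"
    \<comment> \<open>No arrow starts at the zero algebra, so its level would be 0.\<close>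
    have "k = 0" if chain: "(direct_degen n ^^ k) A \<mu>" for k \<mu>
    proof (rule ccontr)
      assume "k \<noteq> 0"
      then obtain l where "k = Suc l" by (cases k) auto
      then have "(direct_degen n ^^ Suc l) A \<mu>" using chain by simp
      from relpowp_Suc_D2[OF this] obtain C where "direct_degen n A C" by blast
      then have C: "degenerates n A C" "\<not> alg_iso n A C" by (auto simp: direct_degen_def nontrivial_degen_def)
      then show False using zero_alg_degenerates[OF C(1) z] iso_zero z by (auto simp: degenerates_iff)
    qed
    then have "Sup ?K \<le> 0" by (intro Sup_least) (auto simp: zero_enat_def)
    then show False using lev unfolding level_def by simp
  qed
  show "rigid n A"
    unfolding rigid_def
  proof (intro conjI A allI impI)
    fix B assume AB: "degenerates n A B"
    show "zero_alg n B \<or> alg_iso n A B"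
    proof (rule ccontr)
      assume "\<not> ?thesis"
      then have "nontrivial_degen n A B" "\<not> zero_alg n B" using AB by (auto simp: nontrivial_degen_def)
      moreover have up: "\<not> zero_alg n C" if "nontrivial_degen n C D" "\<not> zero_alg n D" for C D
        using that zero_alg_degenerates unfolding nontrivial_degen_def by blast
      \<comment> \<open>The first direct arrow is chosen with a non-zero target, so that a second
        arrow can still follow.\<close>
      ultimately obtain C where C: "direct_degen n A C" "\<not> zero_alg n C"
        using direct_degen_exists[of n A B "\<lambda>C. \<not> zero_alg n C"] by blast
      then have Calg: "C \<in> algebras n" by (auto simp: direct_degen_def nontrivial_degen_def degenerates_iff)
      have "\<not> alg_iso n C (abelian n)"
      proof
        assume "alg_iso n C (abelian n)"
        then have "C \<in> orb n (abelian n)"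
          using alg_iso_sym orb_iff_alg_iso Calg abelian_algebras by blast
        then obtain m where m: "m \<in> GL_pairs n"
          "\<And>x y. x \<in> carrier_vec n \<Longrightarrow> y \<in> carrier_vec n \<Longrightarrow> C x y = transport (abelian n) m x y"
          by (rule orbE) blast
        obtain g h where gh: "m = (g, h)" by (cases m)
        have "g \<in> carrier_mat n n" using m gh by (auto dest: GL_pairsD)
        then have "zero_alg n C"
          using m(2) gh by (auto simp: zero_alg_def idx_def sc_def transport_def abelian_def)
        then show False using C by blast
      qed
      then have "nontrivial_degen n C (abelian n)"
        using degenerates_abelian[OF Calg] by (simp add: nontrivial_degen_def)
      \<comment> \<open>The property is trivial here: any direct degeneration of \<open>C\<close>
        completes a chain of two arrows.\<close>
      then obtain D where "direct_degen n C D"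
        using direct_degen_exists[of n C "abelian n" "\<lambda>_. True"] by blast
      then show False using two C by blast
    qed
  qed
qed

theorem theorem2p3:
  fixes n :: nat and A :: mult
  assumes "n \<ge> 3" and "A \<in> algebras n" and "level n A = 1"
  shows "alg_iso n A (p_minus n) \<or>
         alg_iso n A (alg_sum 3 (n - 3) n3_minus (abelian (n - 3))) \<or>
         alg_iso n A (alg_sum 2 (n - 2) lambda2 (abelian (n - 2))) \<or>
         (\<exists>\<alpha>::complex. alg_iso n A (nu n \<alpha>))"
  using rigid_classification[OF assms(1) level_one_rigid[OF assms(2,3)]] .

end
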